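(* Let $m\ge2$, let $H$ be a complex Hilbert space, let $E$ be a POVM on $\Omega_m=\{0,\dots,m-1\}^{\mathbb N}$ with values in $B(H)$, and let $c>0$. There is a one-to-one correspondence $F\mapsto\{X_w\}$ between measures $F\in\mathcal M_+(\Omega_m,H)$ satisfying $F\le cE$ and positive range martingales $\{X_w\}$ for $E$ satisfying $$0\le X_w\le cI_{H_w}$$ for every finite word $w$. The correspondence is characterized by $$F([w])=E_w^{1/2}X_wE_w^{1/2}$$ for every finite word $w$, where $X_w$ is extended by zero on $H_w^\perp$.
   Context: $\Omega_m$ carries its product Borel $\sigma$-algebra $\mathcal B(\Omega_m)$. For a finite word $w=w_1\cdots w_n$ in $\{0,\dots,m-1\}$, $[w]=\{x\in\Omega_m:x_1=w_1,\dots,x_n=w_n\}$; the empty word is $\varnothing$, and $[\varnothing]=\Omega_m$; $wj$ is $w$ with the letter $j$ appended. $\mathcal M_+(\Omega_m,H)$ is the cone of finite positive operator-valued measures, i.e. maps $F:\mathcal B(\Omega_m)\to B(H)_+$ countably additive in the weak operator topology (not assumed normalized). A POVM is such a map $E$ with $E(\Omega_m)=I$. $F\le cE$ means $0\le F(B)\le cE(B)$ for every Borel set $B\subseteq\Omega_m$. Put $E_w=E([w])$ and $H_w=\overline{\operatorname{ran}}(E_w^{1/2})$. For $0\le j\le m-1$, the edge contraction $C_{wj}:H_w\to H_{wj}$ is the unique contraction with $C_{wj}E_w^{1/2}h=E_{wj}^{1/2}h$ for all $h\in H$. A bounded range martingale for $E$ is a family of self-adjoint operators $X_w\in B(H_w)$,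 indexed by all finite words $w$, such that $\sup_w\|X_w\|<\infty$ and $X_w=\sum_{j=0}^{m-1}C_{wj}^*X_{wj}C_{wj}$ for every $w$. A positive range martingale is a bounded range martingale with $X_w\ge0$ for every $w$. *)

theory Defs
  imports "HOL-Analysis.Analysis"
begin

section \<open>Complex Hilbert spaces\<close>

text \<open>
  A complex Hilbert space is presented on top of its underlying real Hilbert space, so that the
  norm, the topology and completeness are those of the library; the real inner product is the real
  part of the complex one. The complex inner product is linear in its first argument.
\<close>

class chilbert_space = real_inner + banach +
  fixes scaleC :: "complex \<Rightarrow> 'a \<Rightarrow> 'a" (infixr "*\<^sub>C" 75)
    and cinner :: "'a \<Rightarrow> 'a \<Rightarrow> complex"
  assumes scaleC_add_right: "a *\<^sub>C (x + y) = a *\<^sub>C x + a *\<^sub>C y"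
    and scaleC_add_left: "(a + b) *\<^sub>C x = a *\<^sub>C x + b *\<^sub>C x"
    and scaleC_scaleC: "a *\<^sub>C b *\<^sub>C x = (a * b) *\<^sub>C x"
    and scaleC_complex_of_real: "complex_of_real r *\<^sub>C x = r *\<^sub>R x"
    and cinner_commute: "cinner x y = cnj (cinner y x)"
    and cinner_add_left: "cinner (x + y) z = cinner x z + cinner y z"
    and cinner_scaleC_left: "cinner (a *\<^sub>C x) y = a * cinner x y"
    and Re_cinner: "Re (cinner x y) = inner x y"

instantiation complex :: chilbert_space
begin

definition scaleC_complex :: "complex \<Rightarrow> complex \<Rightarrow> complex"
  where "scaleC_complex a x = a * x"

definition cinner_complex :: "complex \<Rightarrow> complex \<Rightarrow> complex"
  where "cinner_complex x y = x * cnj y"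

instance
  by standard
    (auto simp: scaleC_complex_def cinner_complex_def inner_complex_def algebra_simps
      scaleR_conv_of_real)

end


section \<open>Bounded operators\<close>

text \<open>The space \<open>B(H)\<close>: the complex-linear ones among the bounded real-linear operators.\<close>

definition bounded_ops :: "('a::chilbert_space \<Rightarrow>\<^sub>L 'a) set"
  where "bounded_ops = {A. \<forall>a x. blinfun_apply A (a *\<^sub>C x) = a *\<^sub>C blinfun_apply A x}"

text \<open>
  For closed subspaces \<open>S\<close> and \<open>T\<close>, an operator in \<open>B(S, T)\<close> is represented by its extension by
  zero on the orthogonal complement of \<open>S\<close>. This representation is bijective and preserves norms,
  sums, compositions and adjoints.
\<close>

definition bounded_ops_between ::
    "'a::chilbert_space set \<Rightarrow> 'a set \<Rightarrow> ('a \<Rightarrow>\<^sub>L 'a) set"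
  where "bounded_ops_between S T =
    {A \<in> bounded_ops. range (blinfun_apply A) \<subseteq> T \<and>
       (\<forall>x. (\<forall>y\<in>S. cinner x y = 0) \<longrightarrow> blinfun_apply A x = 0)}"

definition cadjoint :: "('a::chilbert_space \<Rightarrow>\<^sub>L 'a) \<Rightarrow> ('a \<Rightarrow>\<^sub>L 'a)"
  where "cadjoint A =
    (THE B. \<forall>x y. cinner (blinfun_apply A x) y = cinner x (blinfun_apply B y))"

text \<open>\<open>op_le_on S A B\<close> is the operator order \<open>A \<le> B\<close> for the compressions of \<open>A\<close> and \<open>B\<close> to \<open>S\<close>.\<close>

definition op_le_on ::
    "'a::chilbert_space set \<Rightarrow> ('a \<Rightarrow>\<^sub>L 'a) \<Rightarrow> ('a \<Rightarrow>\<^sub>L 'a) \<Rightarrow> bool"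
  where "op_le_on S A B \<longleftrightarrow>
    (\<forall>x\<in>S. cinner (blinfun_apply (B - A) x) x \<in> \<real>\<^sub>\<ge>\<^sub>0)"

definition positive_ops :: "('a::chilbert_space \<Rightarrow>\<^sub>L 'a) set"
  where "positive_ops = {A \<in> bounded_ops. op_le_on UNIV 0 A}"

definition op_sqrt :: "('a::chilbert_space \<Rightarrow>\<^sub>L 'a) \<Rightarrow> ('a \<Rightarrow>\<^sub>L 'a)"
  where "op_sqrt A = (THE R. R \<in> positive_ops \<and> R o\<^sub>L R = A)"


section \<open>Words and cylinders\<close>

text \<open>
  The sequence space over \<open>{0, \<dots>, m - 1}\<close> with the product Borel \<open>\<sigma>\<close>-algebra. Positions are
  counted from 0, so the coordinate \<open>x\<^sub>1\<close> of the usual notation is \<open>x 0\<close>.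
\<close>

definition sequences :: "nat \<Rightarrow> (nat \<Rightarrow> nat) measure"
  where "sequences m = PiM UNIV (\<lambda>_. count_space {..<m})"

definition words :: "nat \<Rightarrow> nat list set"
  where "words m = lists {..<m}"

definition cylinder :: "nat \<Rightarrow> nat list \<Rightarrow> (nat \<Rightarrow> nat) set"
  where "cylinder m w = {x \<in> space (sequences m). \<forall>i<length w. x i = w ! i}"


section \<open>Operator-valued measures\<close>

text \<open>
  Functions defined on the Borel sets (and below, on the words) are represented by extensional
  functions, so that equality of functions is equality on that domain.
\<close>

type_synonym 'a op_measure = "(nat \<Rightarrow> nat) set \<Rightarrow> ('a \<Rightarrow>\<^sub>L 'a)"

definition positive_op_measures :: "nat \<Rightarrow> 'a::chilbert_space op_measure set"
  where "positive_op_measures m =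
    {F \<in> sets (sequences m) \<rightarrow>\<^sub>E positive_ops.
       \<forall>A. range A \<subseteq> sets (sequences m) \<longrightarrow> disjoint_family A \<longrightarrow>
         (\<forall>h k. (\<lambda>n. cinner (blinfun_apply (F (A n)) h) k) sums
            cinner (blinfun_apply (F (\<Union>n. A n)) h) k)}"

definition povm :: "nat \<Rightarrow> 'a::chilbert_space op_measure \<Rightarrow> bool"
  where "povm m E \<longleftrightarrow>
    E \<in> positive_op_measures m \<and> E (space (sequences m)) = id_blinfun"

definition dominated_by ::
    "nat \<Rightarrow> 'a::chilbert_space op_measure \<Rightarrow> real \<Rightarrow> 'a op_measure \<Rightarrow> bool"
  where "dominated_by m F c E \<longleftrightarrow>
    (\<forall>B\<in>sets (sequences m). op_le_on UNIV 0 (F B) \<and> op_le_on UNIV (F B) (c *\<^sub>R E B))"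


section \<open>Range martingales\<close>

definition sqrt_cyl ::
    "nat \<Rightarrow> 'a::chilbert_space op_measure \<Rightarrow> nat list \<Rightarrow> ('a \<Rightarrow>\<^sub>L 'a)"
  where "sqrt_cyl m E w = op_sqrt (E (cylinder m w))"

definition range_space ::
    "nat \<Rightarrow> 'a::chilbert_space op_measure \<Rightarrow> nat list \<Rightarrow> 'a set"
  where "range_space m E w = closure (range (blinfun_apply (sqrt_cyl m E w)))"

definition edge_contraction ::
    "nat \<Rightarrow> 'a::chilbert_space op_measure \<Rightarrow> nat list \<Rightarrow> nat \<Rightarrow> ('a \<Rightarrow>\<^sub>L 'a)"
  where "edge_contraction m E w j =
    (THE C. C \<in> bounded_ops_between (range_space m E w) (range_space m E (w @ [j])) \<and>
       norm C \<le> 1 \<and>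
       (\<forall>h. blinfun_apply C (blinfun_apply (sqrt_cyl m E w) h) =
            blinfun_apply (sqrt_cyl m E (w @ [j])) h))"

definition bounded_range_martingale ::
    "nat \<Rightarrow> 'a::chilbert_space op_measure \<Rightarrow> (nat list \<Rightarrow> ('a \<Rightarrow>\<^sub>L 'a)) \<Rightarrow> bool"
  where "bounded_range_martingale m E X \<longleftrightarrow>
    X \<in> (\<Pi>\<^sub>E w\<in>words m. bounded_ops_between (range_space m E w) (range_space m E w)) \<and>
    (\<forall>w\<in>words m. cadjoint (X w) = X w) \<and>
    bdd_above ((\<lambda>w. norm (X w)) ` words m) \<and>
    (\<forall>w\<in>words m. X w =
       (\<Sum>j<m. cadjoint (edge_contraction m E w j) o\<^sub>L X (w @ [j]) o\<^sub>L edge_contraction m E w j))"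

definition positive_range_martingale ::
    "nat \<Rightarrow> 'a::chilbert_space op_measure \<Rightarrow> (nat list \<Rightarrow> ('a \<Rightarrow>\<^sub>L 'a)) \<Rightarrow> bool"
  where "positive_range_martingale m E X \<longleftrightarrow>
    bounded_range_martingale m E X \<and> (\<forall>w\<in>words m. op_le_on (range_space m E w) 0 (X w))"

end

theory Submission
  imports Defs
begin

text \<open>
  Write \<open>E\<^sub>w\<close> for the operator of the cylinder of \<open>w\<close>, \<open>R\<^sub>w\<close> for its positive square root and
  \<open>C\<^sub>w\<^sub>j\<close> for the edge contractions.

  A measure \<open>F\<close> with \<open>F \<le> cE\<close> gives operators \<open>0 \<le> F\<^sub>w \<le> cR\<^sub>w\<^sup>2\<close>. Hence the square root of \<open>F\<^sub>w\<close>
  factors as \<open>CR\<^sub>w\<close> with \<open>\<parallel>C\<parallel>\<^sup>2 \<le> c\<close>, and \<open>X\<^sub>w = C\<^sup>*C\<close> is an operator on the closure of the range of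
  \<open>R\<^sub>w\<close> with \<open>F\<^sub>w = R\<^sub>wX\<^sub>wR\<^sub>w\<close> (\<open>ex_compression\<close>). It is the only one (\<open>compression_unique\<close>), and since
  \<open>R\<^sub>w\<^sub>j = C\<^sub>w\<^sub>jR\<^sub>w\<close>, additivity of \<open>F\<close> over the children \<open>wj\<close> of \<open>w\<close> is the same as the martingale equation
  for \<open>X\<close> (\<open>range_martingale_sum\<close>).

  Conversely, a martingale \<open>X\<close> with \<open>0 \<le> X\<^sub>w \<le> c\<close> gives an additive family \<open>G\<^sub>w = R\<^sub>wX\<^sub>wR\<^sub>w\<close> with
  \<open>0 \<le> G\<^sub>w \<le> cE\<^sub>w\<close>, which has to be extended from cylinders to Borel sets (\<open>op_measure_extension\<close>). For a
  fixed vector \<open>h\<close> the numbers \<open>\<nu>\<^sub>w = \<langle>G\<^sub>wh, h\<rangle>\<close> are dominated by \<open>c\<mu>\<close>, where \<open>\<mu> = \<langle>E(\<cdot>)h, h\<rangle>\<close>.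
  The measures with \<open>\<mu>\<close>-density \<open>\<nu>\<^sub>w / \<mu>([w])\<close> on every cylinder \<open>[w]\<close> of level \<open>n\<close> agree with \<open>\<nu>\<close> on
  the cylinders of level at most \<open>n\<close> and are all bounded by \<open>c\<mu>\<close>. By the Dynkin class argument they
  converge setwise on all Borel sets, domination allowing the limit to be exchanged with countable
  sums, and the limit is the required scalar measure \<open>L\<^sub>h\<close> (\<open>sigma_additive_extension\<close>). The polarization
  \<open>(L\<^sub>h\<^sub>+\<^sub>k(B) - L\<^sub>h\<^sub>-\<^sub>k(B)) / 4\<close> is countably additive in \<open>B\<close> and equals \<open>Re \<langle>G\<^sub>wh, k\<rangle>\<close> on cylinders. As
  countably additive functions are determined by their values on cylinders, it is for every \<open>B\<close>
  a bounded positive form, and the Riesz representation theorem yields the operator \<open>F(B)\<close>.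
  The same uniqueness shows that \<open>F\<close> is determined by \<open>X\<close>.

  The Hilbert space theory used here (Riesz representation, adjoints, orthogonal decomposition,
  factorization through a range) all comes from one minimization argument, \<open>riesz_range\<close>, for the real
  inner product; complex linearity is recovered by commutation with multiplication by \<open>\<i>\<close>.
\<close>

section \<open>Riesz representation and factorization through a range\<close>

lemma psd_form_Cauchy_Schwarz:
  fixes b :: "'b::real_vector \<Rightarrow> 'b \<Rightarrow> real"
  assumes lin: "\<And>y. linear (\<lambda>x. b x y)"
    and sym: "\<And>x y. b x y = b y x"
    and pos: "\<And>x. b x x \<ge> 0"
  shows "(b x y)\<^sup>2 \<le> b x x * b y y"
proof -
  have add: "b (u + v) w = b u w + b v w" for u v w
    using linear_add[OF lin] .
  have scale: "b (r *\<^sub>R u) w = r * b u w" for r u w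
    using linear_scale[OF lin] by simp
  have exp: "0 \<le> b x x + 2 * t * b x y + t\<^sup>2 * b y y" for t
  proof -
    have "b (x + t *\<^sub>R y) (x + t *\<^sub>R y) = b x (x + t *\<^sub>R y) + t * b y (x + t *\<^sub>R y)"
      by (simp add: add scale)
    also have "\<dots> = b (x + t *\<^sub>R y) x + t * b (x + t *\<^sub>R y) y"
      using sym by metis
    also have "\<dots> = b x x + t * b y x + t * (b x y + t * b y y)"
      by (simp add: add scale)
    also have "\<dots> = b x x + 2 * t * b x y + t\<^sup>2 * b y y"
      using sym[of y x] by (simp add: algebra_simps power2_eq_square)
    finally show ?thesis using pos[of "x + t *\<^sub>R y"] by simp
  qed
  show ?thesis
  proof (cases "b y y = 0")
    case True
    have "b x y = 0"
    proof (rule ccontr)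
      assume "b x y \<noteq> 0"
      then show False using exp[of "- (b x x + 1) / (2 * b x y)"] True by (simp add: field_simps)
    qed
    then show ?thesis using True by simp
  next
    case False
    then have p: "b y y > 0" using pos[of y] by simp
    have "0 \<le> b y y * (b x x + 2 * (- b x y / b y y) * b x y + (- b x y / b y y)\<^sup>2 * b y y)"
      using exp[of "- b x y / b y y"] p by simp
    also have "\<dots> = b x x * b y y - (b x y)\<^sup>2"
      using p by (simp add: field_simps power2_eq_square)
    finally show ?thesis by simp
  qed
qed

text \<open>
  A bounded functional of \<open>R h\<close> is represented by a vector in the closure of the range of \<open>R\<close>.
  The vector is the limit of \<open>R h\<^sub>n\<close> along a minimizing sequence of \<open>\<parallel>R h\<parallel>\<^sup>2 - 2 f h\<close>, which is Cauchy by
  the parallelogram law. The alternative \<open>z = 0\<close> covers negative \<open>K\<close>, possible only if \<open>R = 0\<close>.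
\<close>

lemma riesz_range:
  fixes R :: "'b::real_vector \<Rightarrow> 'a::{real_inner,banach}"
  assumes R: "linear R" and f: "linear f" and bd: "\<And>h. \<bar>f h\<bar> \<le> K * norm (R h)"
  obtains z where "z \<in> closure (range R)" "\<And>h. inner (R h) z = f h" "norm z \<le> K \<or> z = 0"
proof -
  define Q where "Q h = (norm (R h))\<^sup>2 - 2 * f h" for h
  have Qlow: "Q h \<ge> - K\<^sup>2" for h
  proof -
    have "f h \<le> K * norm (R h)" using bd[of h] by simp
    moreover have "0 \<le> (norm (R h) - K)\<^sup>2" by simp
    ultimately show ?thesis by (simp add: Q_def power2_eq_square algebra_simps)
  qed
  define q where "q = Inf (range Q)"
  have bb: "bdd_below (range Q)" using Qlow by (auto intro!: bdd_belowI[of _ "- K\<^sup>2"])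
  have qle: "q \<le> Q h" for h unfolding q_def by (rule cInf_lower[OF _ bb]) auto
  have "\<exists>h. Q h < q + 1 / real (Suc n)" for n
    using cInf_lessD[of "range Q" "q + 1 / real (Suc n)"] by (auto simp: q_def)
  then obtain h where h: "\<And>n. Q (h n) < q + 1 / real (Suc n)" by metis
  have Qexp: "Q (x + t *\<^sub>R k) = Q x + 2 * t * (inner (R x) (R k) - f k) + t\<^sup>2 * (norm (R k))\<^sup>2" for x k t
    by (simp add: Q_def linear_add[OF R] linear_scale[OF R] linear_add[OF f] linear_scale[OF f]
        power2_norm_eq_inner inner_add inner_commute algebra_simps power2_eq_square[of t])
  have par: "(norm (R x - R y))\<^sup>2 = 2 * Q x + 2 * Q y - 4 * Q ((1/2) *\<^sub>R (x + y))" for x y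
    by (simp add: Q_def linear_add[OF R] linear_scale[OF R] linear_add[OF f] linear_scale[OF f]
        power2_norm_eq_inner inner_add inner_diff inner_commute algebra_simps)
  have close: "(norm (R (h i) - R (h j)))\<^sup>2 \<le> 4 / real (Suc n)" if "i \<ge> n" "j \<ge> n" for i j n
  proof -
    have "1 / real (Suc i) \<le> 1 / real (Suc n)" "1 / real (Suc j) \<le> 1 / real (Suc n)"
      using that by (auto intro!: divide_left_mono)
    then show ?thesis
      using par[of "h i" "h j"] h[of i] h[of j] qle[of "(1/2) *\<^sub>R (h i + h j)"] by simp
  qed
  have "Cauchy (\<lambda>n. R (h n))"
  proof (rule metric_CauchyI)
    fix e :: real assume e: "e > 0"
    obtain n where n: "4 / e\<^sup>2 < real (Suc n)"
      using reals_Archimedean2[of "4 / e\<^sup>2"] by (metis less_Suc_eq of_nat_less_iff order_less_trans)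
    then have "4 / real (Suc n) < e\<^sup>2" using e by (simp add: field_simps)
    then have "dist (R (h i)) (R (h j)) < e" if "i \<ge> n" "j \<ge> n" for i j
      using close[OF that] e by (auto simp: dist_norm intro: power2_less_imp_less)
    then show "\<exists>M. \<forall>i\<ge>M. \<forall>j\<ge>M. dist (R (h i)) (R (h j)) < e" by blast
  qed
  then obtain z where z: "(\<lambda>n. R (h n)) \<longlonglongrightarrow> z"
    using Cauchy_convergent_iff convergent_def by blast
  have zcl: "z \<in> closure (range R)" unfolding closure_sequential using z by (intro exI[of _ "\<lambda>n. R (h n)"]) auto
  have "(\<lambda>n. q + 1 / real (Suc n)) \<longlonglongrightarrow> q + 0"
    by (rule tendsto_add[OF tendsto_const LIMSEQ_Suc[OF lim_1_over_n]])
  then have Qlim: "(\<lambda>n. Q (h n)) \<longlonglongrightarrow> q"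
    by (intro tendsto_sandwich[of "\<lambda>_. q" "\<lambda>n. Q (h n)" _ "\<lambda>n. q + 1 / real (Suc n)"])
       (auto intro!: always_eventually qle less_imp_le[OF h] simp del: of_nat_Suc)
  have nonneg: "0 \<le> 2 * t * (inner z (R k) - f k) + t\<^sup>2 * (norm (R k))\<^sup>2" for t k
  proof -
    have "(\<lambda>n. Q (h n + t *\<^sub>R k)) \<longlonglongrightarrow> q + 2 * t * (inner z (R k) - f k) + t\<^sup>2 * (norm (R k))\<^sup>2"
      unfolding Qexp by (intro tendsto_intros Qlim z)
    then have "q \<le> q + 2 * t * (inner z (R k) - f k) + t\<^sup>2 * (norm (R k))\<^sup>2"
      by (rule LIMSEQ_le_const) (use qle in auto)
    then show ?thesis by simp
  qed
  \<comment> \<open>The derivative of the quadratic function at its minimum vanishes; the \<open>+ 1\<close> in \<open>d\<close> avoids division by zero.\<close>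
  have eq: "inner (R k) z = f k" for k
  proof -
    define a where "a = inner z (R k) - f k"
    define d where "d = (norm (R k))\<^sup>2 + 1"
    have d: "d > 0" "(norm (R k))\<^sup>2 = d - 1" by (auto simp: d_def add_nonneg_pos)
    have "0 \<le> 2 * (- a / d) * a + (- a / d)\<^sup>2 * (d - 1)"
      using nonneg[of "- a / d" k] by (simp only: a_def[symmetric] d(2))
    also have "\<dots> = - (a\<^sup>2 * (d + 1)) / d\<^sup>2"
      using d by (simp add: field_simps power2_eq_square)
    finally have "a\<^sup>2 * (d + 1) \<le> 0" using d by (simp add: field_simps)
    then have "a = 0" using d by (simp add: mult_le_0_iff)
    then show ?thesis by (simp add: a_def inner_commute)
  qed
  have "(\<lambda>n. inner (R (h n)) z) \<longlonglongrightarrow> inner z z" by (intro tendsto_intros z)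
  moreover have "(\<lambda>n. K * norm (R (h n))) \<longlonglongrightarrow> K * norm z" by (intro tendsto_intros z)
  ultimately have "inner z z \<le> K * norm z"
    using bd by (intro LIMSEQ_le) (auto simp: eq abs_le_iff)
  then have "norm z \<le> K \<or> z = 0"
    by (auto simp: power2_norm_eq_inner[symmetric] power2_eq_square)
  then show ?thesis using that zcl eq by blast
qed

lemma inner_cancel_right:
  fixes u v :: "'a::real_inner"
  assumes "\<And>x. inner x u = inner x v"
  shows "u = v"
  using assms[of "u - v"] inner_eq_zero_iff[of "u - v"] by (simp add: inner_diff_right)

lemma closure_range_sequence:
  fixes R :: "'b \<Rightarrow> 'a::metric_space"
  assumes "z \<in> closure (range R)"
  obtains h where "(\<lambda>n. R (h n)) \<longlonglongrightarrow> z"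
proof -
  obtain x where x: "\<And>n. x n \<in> range R" "x \<longlonglongrightarrow> z"
    using assms unfolding closure_sequential by blast
  have "R (inv R (x n)) = x n" for n using x(1) by (rule f_inv_into_f)
  then have "(\<lambda>n. R (inv R (x n))) \<longlonglongrightarrow> z" using x(2) by simp
  then show ?thesis by (rule that)
qed

lemma closure_range_unique:
  fixes R :: "'b::real_vector \<Rightarrow> 'a::real_inner"
  assumes R: "linear R" and z: "z \<in> closure (range R)" and 0: "\<And>h. inner (R h) z = 0"
  shows "z = 0"
proof -
  obtain h where "(\<lambda>n. R (h n)) \<longlonglongrightarrow> z"
    using closure_range_sequence[OF z] by blast
  then have "(\<lambda>n. inner (R (h n)) z) \<longlonglongrightarrow> inner z z" by (intro tendsto_intros)
  then have "inner z z = 0" by (simp add: 0 LIMSEQ_const_iff)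
  then show ?thesis by simp
qed

lemma orthogonal_decomposition:
  fixes R :: "'b::real_vector \<Rightarrow> 'a::{real_inner,banach}"
  assumes R: "linear R"
  obtains p where "p \<in> closure (range R)" "\<And>h. inner (R h) (x - p) = 0"
proof -
  have "linear (\<lambda>h. inner (R h) x)"
    by (intro linearI) (simp_all add: linear_add[OF R] linear_scale[OF R] inner_add)
  moreover have "\<bar>inner (R h) x\<bar> \<le> norm x * norm (R h)" for h
    by (metis Cauchy_Schwarz_ineq2 mult.commute)
  ultimately obtain z where "z \<in> closure (range R)" "\<And>h. inner (R h) z = inner (R h) x"
    by (rule riesz_range[OF R]) auto
  then show ?thesis using that by (simp add: inner_diff_right)
qed

text \<open>
  The closure of the range is its own double orthogonal complement.
\<close>

lemma in_closure_range_iff: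
  fixes R :: "'b::real_vector \<Rightarrow> 'a::{real_inner,banach}"
  assumes R: "linear R"
  shows "y \<in> closure (range R) \<longleftrightarrow> (\<forall>x. (\<forall>h. inner (R h) x = 0) \<longrightarrow> inner y x = 0)"
proof
  assume "y \<in> closure (range R)"
  then obtain h where h: "(\<lambda>n. R (h n)) \<longlonglongrightarrow> y"
    using closure_range_sequence by blast
  have "inner y x = 0" if "\<forall>h. inner (R h) x = 0" for x
  proof -
    have "(\<lambda>n. inner (R (h n)) x) \<longlonglongrightarrow> inner y x" by (intro tendsto_intros h)
    then show ?thesis using that by (simp add: LIMSEQ_const_iff)
  qed
  then show "\<forall>x. (\<forall>h. inner (R h) x = 0) \<longrightarrow> inner y x = 0" by blast
next
  assume *: "\<forall>x. (\<forall>h. inner (R h) x = 0) \<longrightarrow> inner y x = 0"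
  obtain p where p: "p \<in> closure (range R)" "\<And>h. inner (R h) (y - p) = 0"
    using orthogonal_decomposition[OF R] by blast
  obtain h where h: "(\<lambda>n. R (h n)) \<longlonglongrightarrow> p"
    using closure_range_sequence[OF p(1)] by blast
  have "(\<lambda>n. inner (R (h n)) (y - p)) \<longlonglongrightarrow> inner p (y - p)" by (intro tendsto_intros h)
  then have "inner p (y - p) = 0" using p(2) by (simp add: LIMSEQ_const_iff)
  moreover have "inner y (y - p) = 0" using * p(2) by blast
  ultimately have "inner (y - p) (y - p) = 0" by (simp add: inner_diff_left)
  then show "y \<in> closure (range R)" using p(1) by simp
qed

lemma subspace_closure_range:
  fixes R :: "'b::real_vector \<Rightarrow> 'a::{real_inner,banach}"
  assumes "linear R"
  shows "subspace (closure (range R))"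
proof -
  note iff = in_closure_range_iff[OF assms]
  have "x + y \<in> closure (range R)" if "x \<in> closure (range R)" "y \<in> closure (range R)" for x y
    using that unfolding iff by (simp add: inner_add_left)
  moreover have "r *\<^sub>R x \<in> closure (range R)" if "x \<in> closure (range R)" for r x
    using that unfolding iff by simp
  moreover have "0 \<in> closure (range R)"
    unfolding iff by simp
  ultimately show ?thesis by (simp add: subspace_def)
qed

text \<open>
  Specializations: adjoints (\<open>R\<close> the identity), operators of bounded forms, and the adjoint of the
  factor of one operator through another.
\<close>

lemma ex_form_representation:
  fixes R :: "'b::real_vector \<Rightarrow> 'a::{real_inner,banach}" and b :: "'b \<Rightarrow> 'c::real_normed_vector \<Rightarrow> real"
  assumes R: "linear R" and lin1: "\<And>y. linear (\<lambda>h. b h y)" and lin2: "\<And>h. linear (b h)"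
    and bd: "\<And>h y. \<bar>b h y\<bar> \<le> K * norm (R h) * norm y" and K: "0 \<le> K"
  obtains D :: "'c \<Rightarrow>\<^sub>L 'a" where "\<And>h y. inner (R h) (D y) = b h y" "norm D \<le> K"
    "\<And>y. D y \<in> closure (range R)"
proof -
  have "\<exists>z. z \<in> closure (range R) \<and> (\<forall>h. inner (R h) z = b h y) \<and> norm z \<le> K * norm y" for y
  proof -
    have "\<bar>b h y\<bar> \<le> (K * norm y) * norm (R h)" for h
      using bd[of h y] by (simp add: algebra_simps)
    then obtain z where "z \<in> closure (range R)" "\<And>h. inner (R h) z = b h y"
        "norm z \<le> K * norm y \<or> z = 0"
      by (rule riesz_range[OF R lin1]) auto
    then show ?thesis using K by (intro exI[of _ z]) auto
  qed
  then obtain D where D: "\<And>y. D y \<in> closure (range R)" "\<And>h y. inner (R h) (D y) = b h y"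
      "\<And>y. norm (D y) \<le> K * norm y" by metis
  have ext: "u = v" if "u \<in> closure (range R)" "v \<in> closure (range R)"
    "\<And>h. inner (R h) u = inner (R h) v" for u v
    using closure_range_unique[OF R, of "u - v"] that
      subspace_diff[OF subspace_closure_range[OF R]] by (simp add: inner_diff_right)
  note sub = subspace_closure_range[OF R]
  have add: "b h (y + z) = b h y + b h z" and scale: "b h (r *\<^sub>R y) = r * b h y" for h y z r
    using linear_add[OF lin2] linear_scale[OF lin2] by auto
  have "bounded_linear D"
    by (rule bounded_linear_intro[of _ K])
       (auto intro!: ext D(1) subspace_add[OF sub] subspace_scale[OF sub]
         simp: D(2,3) inner_add_right mult.commute[of _ K] add scale)
  then have Dapp: "blinfun_apply (Blinfun D) = D" by (simp add: bounded_linear_Blinfun_apply)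
  then have "norm (Blinfun D) \<le> K" using D(3) K by (intro norm_blinfun_bound) auto
  then show ?thesis using D(1,2) by (intro that[of "Blinfun D"]) (simp_all add: Dapp)
qed

lemma ex_adjoint:
  fixes A :: "'a::{real_inner,banach} \<Rightarrow>\<^sub>L 'b::real_inner"
  obtains B :: "'b \<Rightarrow>\<^sub>L 'a" where "\<And>x y. inner (A x) y = inner x (B y)" "norm B \<le> norm A"
proof -
  have lin: "linear (\<lambda>x. inner (A x) y)" "linear (inner (A x))" for x y
    by (auto intro!: linearI simp: blinfun.add_right blinfun.scaleR_right inner_add)
  have bd: "\<bar>inner (A x) y\<bar> \<le> norm A * norm x * norm y" for x y
    using Cauchy_Schwarz_ineq2[of "A x" y] mult_right_mono[OF norm_blinfun[of A x], of "norm y"]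
    by simp
  obtain B :: "'b \<Rightarrow>\<^sub>L 'a" where "\<And>x y. inner x (B y) = inner (A x) y" "norm B \<le> norm A"
    by (rule ex_form_representation[OF linear_ident lin bd norm_ge_zero]) blast
  then show ?thesis by (intro that[of B]) simp_all
qed

lemma blinfun_eq_on_range:
  fixes A B :: "'a::{real_inner,banach} \<Rightarrow>\<^sub>L 'c::real_normed_vector"
  assumes R: "linear R" and eq: "\<And>h. A (R h) = B (R h)"
    and 0: "\<And>x. (\<forall>h. inner (R h) x = 0) \<Longrightarrow> A x = B x"
  shows "A = B"
proof (rule blinfun_eqI)
  fix x
  obtain p where p: "p \<in> closure (range R)" "\<And>h. inner (R h) (x - p) = 0"
    using orthogonal_decomposition[OF R] by blast
  obtain h where h: "(\<lambda>n. R (h n)) \<longlonglongrightarrow> p"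
    using closure_range_sequence[OF p(1)] by blast
  have "(\<lambda>n. A (R (h n))) \<longlonglongrightarrow> A p" "(\<lambda>n. B (R (h n))) \<longlonglongrightarrow> B p" by (intro tendsto_intros h)+
  then have "A p = B p" unfolding eq by (rule LIMSEQ_unique)
  moreover have "A (x - p) = B (x - p)" using 0 p(2) by blast
  ultimately show "A x = B x" by (simp add: blinfun.diff_right)
qed

text \<open>
  Douglas factorization: an operator dominated by \<open>R\<close> is \<open>C R\<close> with \<open>C\<close> zero on the orthogonal
  complement of the range of \<open>R\<close>. The adjoint of \<open>C\<close> is constructed first.
\<close>

lemma ex_range_factor:
  fixes R :: "'b::real_vector \<Rightarrow> 'a::{real_inner,banach}" and S :: "'b \<Rightarrow> 'a"
  assumes R: "linear R" and S: "linear S" and bd: "\<And>h. norm (S h) \<le> K * norm (R h)" and K: "0 \<le> K"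
  obtains C :: "'a \<Rightarrow>\<^sub>L 'a" where "\<And>h. C (R h) = S h"
    "\<And>x. (\<forall>h. inner (R h) x = 0) \<Longrightarrow> C x = 0" "norm C \<le> K" "range C \<subseteq> closure (range S)"
proof -
  have lin: "linear (\<lambda>h. inner (S h) y)" "linear (inner (S h))" for h y
    by (auto intro!: linearI simp: linear_add[OF S] linear_scale[OF S] inner_add)
  have bd': "\<bar>inner (S h) y\<bar> \<le> K * norm (R h) * norm y" for h y
    using Cauchy_Schwarz_ineq2[of "S h" y] mult_right_mono[OF bd[of h], of "norm y"] by simp
  obtain D :: "'a \<Rightarrow>\<^sub>L 'a" where D: "\<And>h y. inner (R h) (D y) = inner (S h) y"
      "norm D \<le> K" "\<And>y. D y \<in> closure (range R)"
    by (rule ex_form_representation[OF R lin bd' K]) blast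
  obtain C :: "'a \<Rightarrow>\<^sub>L 'a" where C: "\<And>x y. inner (D x) y = inner x (C y)" "norm C \<le> norm D"
    by (rule ex_adjoint[of D]) blast
  have "C (R h) = S h" for h
  proof -
    have "inner (C (R h) - S h) y = 0" for y
      using D(1)[of h y] C(1)[of y "R h"]
      by (simp add: inner_diff_left inner_diff_right inner_commute)
    then show ?thesis using inner_eq_zero_iff[of "C (R h) - S h"] by simp
  qed
  moreover have "C x = 0" if "\<forall>h. inner (R h) x = 0" for x
  proof -
    have "inner (C x) (C x) = inner (D (C x)) x" by (simp add: C(1))
    also have "\<dots> = 0" using D(3) in_closure_range_iff[OF R] that by blast
    finally show ?thesis by simp
  qed
  moreover have "C x \<in> closure (range S)" for x
    unfolding in_closure_range_iff[OF S]
  proof (intro allI impI)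
    fix y assume "\<forall>h. inner (S h) y = 0"
    then have "D y = 0" using closure_range_unique[OF R D(3)] D(1) by simp
    then show "inner (C x) y = 0" using C(1)[of y x] by (simp add: inner_commute)
  qed
  moreover have "norm C \<le> K" using C(2) D(2) by simp
  ultimately show ?thesis by (intro that) auto
qed


section \<open>Square roots of positive operators\<close>

text \<open>
  Self-adjointness for the real inner product; for complex-linear operators this is self-adjointness.
\<close>

definition symmetric_op :: "('a::real_inner \<Rightarrow>\<^sub>L 'a) \<Rightarrow> bool"
  where "symmetric_op A \<longleftrightarrow> (\<forall>x y. inner (A x) y = inner x (A y))"

text \<open>
  Positive operators of the real inner product. Symmetry has to be required, as over the reals it
  does not follow from positivity of the quadratic form.
\<close>

definition psd_op :: "('a::real_inner \<Rightarrow>\<^sub>L 'a) \<Rightarrow> bool"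
  where "psd_op A \<longleftrightarrow> symmetric_op A \<and> (\<forall>x. inner (A x) x \<ge> 0)"

lemma psd_op_Cauchy_Schwarz:
  assumes "psd_op A"
  shows "(inner (A x) y)\<^sup>2 \<le> inner (A x) x * inner (A y) y"
proof (rule psd_form_Cauchy_Schwarz)
  show "linear (\<lambda>x. inner (A x) y)" for y
    by (intro linearI) (simp_all add: blinfun.add_right blinfun.scaleR_right inner_add)
  show "inner (A x) y = inner (A y) x" for x y
    using assms by (metis psd_op_def symmetric_op_def inner_commute)
  show "inner (A x) x \<ge> 0" for x
    using assms by (simp add: psd_op_def)
qed

lemma psd_op_zero:
  assumes "psd_op A" "inner (A x) x = 0"
  shows "A x = 0"
  using psd_op_Cauchy_Schwarz[OF assms(1), of x "A x"] assms(2) by simp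

text \<open>The Cauchy-Schwarz inequality of the form of \<open>A\<close>, applied to \<open>x\<close> and \<open>A x\<close>.\<close>

lemma psd_op_norm_le_1:
  assumes "psd_op A" and "\<And>x. inner (A x) x \<le> (norm x)\<^sup>2"
  shows "norm A \<le> 1"
proof (rule norm_blinfun_bound)
  fix x
  have "((norm (A x))\<^sup>2)\<^sup>2 = (inner (A x) (A x))\<^sup>2"
    by (simp add: power2_norm_eq_inner)
  also have "\<dots> \<le> inner (A x) x * inner (A (A x)) (A x)"
    by (rule psd_op_Cauchy_Schwarz[OF assms(1)])
  also have "\<dots> \<le> (norm x)\<^sup>2 * (norm (A x))\<^sup>2"
    using assms by (intro mult_mono) (auto simp: psd_op_def)
  finally have "(norm (A x))\<^sup>2 * (norm (A x))\<^sup>2 \<le> (norm x)\<^sup>2 * (norm (A x))\<^sup>2"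
    by (simp only: power2_eq_square[of "(norm (A x))\<^sup>2"])
  then have "(norm (A x))\<^sup>2 \<le> (norm x)\<^sup>2" if "A x \<noteq> 0"
    by (rule mult_right_le_imp_le) (use that in simp)
  then show "norm (A x) \<le> 1 * norm x"
    by (cases "A x = 0") (auto intro: power2_le_imp_le)
qed simp

lemma compose_assoc: "A o\<^sub>L (B o\<^sub>L C) = (A o\<^sub>L B) o\<^sub>L C"
  by (rule blinfun_eqI) simp

lemmas compose_tendsto = bounded_bilinear.tendsto[OF bounded_bilinear_blinfun_compose]
  and compose_diff_left = bounded_bilinear.diff_left[OF bounded_bilinear_blinfun_compose]
  and compose_diff_right = bounded_bilinear.diff_right[OF bounded_bilinear_blinfun_compose]
  and compose_add_left = bounded_bilinear.add_left[OF bounded_bilinear_blinfun_compose]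
  and compose_add_right = bounded_bilinear.add_right[OF bounded_bilinear_blinfun_compose]
  and compose_scaleR_left = bounded_bilinear.scaleR_left[OF bounded_bilinear_blinfun_compose]
  and compose_scaleR_right = bounded_bilinear.scaleR_right[OF bounded_bilinear_blinfun_compose]

text \<open>
  For \<open>\<parallel>B\<parallel> \<le> 1\<close> these iterates converge to a solution of \<open>Y = (B + Y\<^sup>2) / 2\<close>, and then
  \<open>(1 - Y)\<^sup>2 = 1 - B\<close>.
\<close>

primrec sqrt_iterate :: "('a::real_normed_vector \<Rightarrow>\<^sub>L 'a) \<Rightarrow> nat \<Rightarrow> ('a \<Rightarrow>\<^sub>L 'a)"
  where "sqrt_iterate B 0 = 0"
  | "sqrt_iterate B (Suc n) = (1/2) *\<^sub>R (B + (sqrt_iterate B n o\<^sub>L sqrt_iterate B n))"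

text \<open>
  The same recursion for the number \<open>B = 1\<close>. Its increments dominate the norms of the increments of
  \<open>sqrt_iterate B\<close>, which gives convergence in norm without any power series.
\<close>

primrec sqrt_majorant :: "nat \<Rightarrow> real"
  where "sqrt_majorant 0 = 0"
  | "sqrt_majorant (Suc n) = (1 + (sqrt_majorant n)\<^sup>2) / 2"

lemma sqrt_majorant_bounds: "0 \<le> sqrt_majorant n \<and> sqrt_majorant n \<le> 1"
proof (induction n)
  case (Suc n)
  then have "(sqrt_majorant n)\<^sup>2 \<le> 1" by (simp add: power_le_one)
  then show ?case by simp
qed simp

lemma sqrt_majorant_Suc: "sqrt_majorant n \<le> sqrt_majorant (Suc n)"
proof -
  have "0 \<le> (1 - sqrt_majorant n)\<^sup>2" by simp
  then show ?thesis by (simp add: power2_eq_square algebra_simps)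
qed

lemma sqrt_iterate_convergent:
  fixes B :: "'a::{real_inner,banach} \<Rightarrow>\<^sub>L 'a"
  assumes B: "norm B \<le> 1"
  obtains Y where "sqrt_iterate B \<longlonglongrightarrow> Y" "norm Y \<le> 1"
proof -
  let ?Y = "sqrt_iterate B" and ?a = sqrt_majorant
  have nY: "norm (?Y n) \<le> ?a n" for n
  proof (induction n)
    case (Suc n)
    have "norm (B + (?Y n o\<^sub>L ?Y n)) \<le> 1 + ?a n * ?a n"
      using norm_triangle_ineq[of B "?Y n o\<^sub>L ?Y n"] norm_blinfun_compose[of "?Y n" "?Y n"] B
        mult_mono[OF Suc Suc] sqrt_majorant_bounds[of n] by (simp del: norm_blinfun_compose)
    then show ?case by (simp add: power2_eq_square)
  qed simp
  \<comment> \<open>\<open>U\<^sup>2 - V\<^sup>2 = U (U - V) + (U - V) V\<close> needs no commutativity and matches the scalar recursion.\<close>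
  have step: "norm (?Y (Suc n) - ?Y n) \<le> ?a (Suc n) - ?a n" for n
  proof (induction n)
    case 0
    then show ?case using B by simp
  next
    case (Suc n)
    let ?D = "?Y (Suc n) - ?Y n" and ?d = "?a (Suc n) - ?a n"
    have "?Y (Suc (Suc n)) - ?Y (Suc n)
        = (1/2) *\<^sub>R ((?Y (Suc n) o\<^sub>L ?Y (Suc n)) - (?Y n o\<^sub>L ?Y n))"
      unfolding sqrt_iterate.simps(2)[of B "Suc n"] sqrt_iterate.simps(2)[of B n]
      by (simp only: scaleR_diff_right[symmetric] add_diff_cancel_left)
    also have "(?Y (Suc n) o\<^sub>L ?Y (Suc n)) - (?Y n o\<^sub>L ?Y n) = (?Y (Suc n) o\<^sub>L ?D) + (?D o\<^sub>L ?Y n)"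
      by (simp only: compose_diff_left compose_diff_right) simp
    finally have "norm (?Y (Suc (Suc n)) - ?Y (Suc n))
        \<le> (1/2) * (norm (?Y (Suc n) o\<^sub>L ?D) + norm (?D o\<^sub>L ?Y n))"
      by (simp add: norm_triangle_ineq del: sqrt_iterate.simps)
    also have "\<dots> \<le> (1/2) * (?a (Suc n) * ?d + ?d * ?a n)"
    proof (intro mult_left_mono add_mono)
      show "norm (?Y (Suc n) o\<^sub>L ?D) \<le> ?a (Suc n) * ?d"
        using norm_blinfun_compose[of "?Y (Suc n)" ?D] mult_mono[OF nY[of "Suc n"] Suc]
          sqrt_majorant_bounds[of "Suc n"] by (meson norm_ge_zero order_trans)
      show "norm (?D o\<^sub>L ?Y n) \<le> ?d * ?a n"
        using norm_blinfun_compose[of ?D "?Y n"] mult_mono[OF Suc nY[of n]]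
          sqrt_majorant_Suc[of n] by (meson norm_ge_zero order_trans diff_ge_0_iff_ge)
    qed simp
    also have "\<dots> = ((?a (Suc n))\<^sup>2 - (?a n)\<^sup>2) / 2"
      by (simp add: power2_eq_square algebra_simps del: sqrt_majorant.simps)
    also have "\<dots> = ?a (Suc (Suc n)) - ?a (Suc n)"
      unfolding sqrt_majorant.simps(2)[of "Suc n"] sqrt_majorant.simps(2)[of n]
      by (simp add: field_simps)
    finally show ?case .
  qed
  have inc: "incseq ?a" using sqrt_majorant_Suc by (rule incseq_SucI)
  have diff: "norm (?Y (n + k) - ?Y n) \<le> ?a (n + k) - ?a n" for n k
  proof (induction k)
    case (Suc k)
    have "norm (?Y (n + Suc k) - ?Y n) \<le> norm (?Y (Suc (n + k)) - ?Y (n + k)) + norm (?Y (n + k) - ?Y n)"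
      using norm_triangle_ineq[of "?Y (Suc (n + k)) - ?Y (n + k)" "?Y (n + k) - ?Y n"]
      by (simp del: sqrt_iterate.simps)
    then show ?case using Suc step[of "n + k"] by simp
  qed simp
  have "Bseq ?a" using sqrt_majorant_bounds by (intro BseqI'[of _ 1]) auto
  then have "Cauchy ?a" using inc Bseq_monoseq_convergent[of ?a]
    by (simp add: Cauchy_convergent_iff incseq_imp_monoseq)
  have "Cauchy ?Y"
  proof (rule metric_CauchyI)
    fix e :: real assume "e > 0"
    obtain M where M: "\<And>i j. i \<ge> M \<Longrightarrow> j \<ge> M \<Longrightarrow> dist (?a i) (?a j) < e"
      using metric_CauchyD[OF \<open>Cauchy ?a\<close> \<open>e > 0\<close>] by blast
    have le: "dist (?Y i) (?Y j) < e" if iM: "i \<ge> M" and ij: "i \<le> j" for i j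
    proof -
      obtain k where k: "j = i + k" using le_Suc_ex[OF ij] by blast
      have "dist (?Y i) (?Y j) = norm (?Y (i + k) - ?Y i)"
        by (simp only: k dist_norm norm_minus_commute)
      also have "\<dots> \<le> ?a (i + k) - ?a i" by (rule diff)
      also have "\<dots> \<le> dist (?a i) (?a j)" by (simp add: k dist_real_def)
      finally show ?thesis using M[of i j] iM ij by simp
    qed
    have "dist (?Y i) (?Y j) < e" if "i \<ge> M" "j \<ge> M" for i j
      using le[of i j] le[of j i] that by (cases "i \<le> j") (auto simp: dist_commute)
    then show "\<exists>M. \<forall>i\<ge>M. \<forall>j\<ge>M. dist (?Y i) (?Y j) < e" by blast
  qed
  then obtain Y where Y: "?Y \<longlonglongrightarrow> Y" using Cauchy_convergent_iff convergent_def by blast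
  have "norm (?Y n) \<le> 1" for n using nY[of n] sqrt_majorant_bounds[of n] by linarith
  then have "norm Y \<le> 1" by (intro LIMSEQ_le_const2[OF tendsto_norm[OF Y]]) auto
  then show ?thesis using that Y by blast
qed

lemma symmetric_op_limit:
  assumes "X \<longlonglongrightarrow> Y" "\<And>n::nat. symmetric_op (X n)"
  shows "symmetric_op Y"
  unfolding symmetric_op_def
proof (intro allI)
  fix x y
  have 1: "(\<lambda>n. inner (X n x) y) \<longlonglongrightarrow> inner (Y x) y"
    by (intro tendsto_inner blinfun.tendsto assms(1) tendsto_const)
  have 2: "(\<lambda>n. inner x (X n y)) \<longlonglongrightarrow> inner x (Y y)"
    by (intro tendsto_inner blinfun.tendsto assms(1) tendsto_const)
  have "inner (X n x) y = inner x (X n y)" for n using assms(2) by (simp add: symmetric_op_def)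
  then show "inner (Y x) y = inner x (Y y)" using LIMSEQ_unique[OF 1] 2 by simp
qed

lemma ex_psd_sqrt_contraction:
  fixes A :: "'a::{real_inner,banach} \<Rightarrow>\<^sub>L 'a"
  assumes A: "psd_op A" and le: "\<And>x. inner (A x) x \<le> (norm x)\<^sup>2"
  obtains S where "psd_op S" "S o\<^sub>L S = A" "\<And>T. T o\<^sub>L A = A o\<^sub>L T \<Longrightarrow> T o\<^sub>L S = S o\<^sub>L T"
proof -
  define B where "B = id_blinfun - A"
  have symA: "inner (A x) y = inner x (A y)" for x y
    using A by (simp add: psd_op_def symmetric_op_def)
  have symB: "inner (B x) y = inner x (B y)" for x y
    by (simp add: B_def blinfun.diff_left inner_diff symA)
  have "psd_op B"
    unfolding psd_op_def symmetric_op_def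
  proof (intro conjI allI symB)
    show "0 \<le> inner (B x) x" for x
      using le[of x] by (simp add: B_def blinfun.diff_left inner_diff_left power2_norm_eq_inner)
  qed
  moreover have "inner (B x) x \<le> (norm x)\<^sup>2" for x
    using A by (simp add: psd_op_def B_def blinfun.diff_left inner_diff_left power2_norm_eq_inner)
  ultimately have "norm B \<le> 1" by (rule psd_op_norm_le_1)
  then obtain Y where Y: "sqrt_iterate B \<longlonglongrightarrow> Y" and nY: "norm Y \<le> 1"
    by (rule sqrt_iterate_convergent)
  have "(\<lambda>n. sqrt_iterate B (Suc n)) \<longlonglongrightarrow> (1/2) *\<^sub>R (B + (Y o\<^sub>L Y))"
    unfolding sqrt_iterate.simps by (intro tendsto_intros compose_tendsto Y)
  then have fixp: "Y = (1/2) *\<^sub>R (B + (Y o\<^sub>L Y))"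
    using LIMSEQ_unique[OF LIMSEQ_Suc[OF Y]] by blast
  have "symmetric_op (sqrt_iterate B n)" for n
  proof (induction n)
    case 0
    then show ?case by (simp add: symmetric_op_def)
  next
    case (Suc n)
    then show ?case
      by (simp add: symmetric_op_def blinfun.add_left blinfun.scaleR_left inner_add symB)
  qed
  then have symY: "inner (Y x) y = inner x (Y y)" for x y
    using symmetric_op_limit[OF Y] by (simp add: symmetric_op_def)
  define S where "S = id_blinfun - Y"
  have "inner (Y x) x \<le> (norm x)\<^sup>2" for x
  proof -
    have "inner (Y x) x \<le> norm (Y x) * norm x" by (rule norm_cauchy_schwarz)
    also have "\<dots> \<le> (norm Y * norm x) * norm x" by (intro mult_right_mono norm_blinfun) auto
    also have "\<dots> \<le> (1 * norm x) * norm x" by (intro mult_right_mono nY) auto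
    finally show ?thesis by (simp add: power2_eq_square)
  qed
  then have "psd_op S"
    by (simp add: psd_op_def symmetric_op_def S_def blinfun.diff_left inner_diff symY
        power2_norm_eq_inner)
  moreover have "S o\<^sub>L S = A"
  proof -
    have "2 *\<^sub>R Y = B + (Y o\<^sub>L Y)" by (subst fixp) simp
    then have e: "Y o\<^sub>L Y = 2 *\<^sub>R Y - B" by simp
    have "S o\<^sub>L S = id_blinfun - Y - (Y - (Y o\<^sub>L Y))"
      unfolding S_def by (rule blinfun_eqI) (simp add: blinfun.diff_left blinfun.diff_right)
    then show ?thesis unfolding e by (simp add: B_def scaleR_2)
  qed
  moreover have "T o\<^sub>L S = S o\<^sub>L T" if T: "T o\<^sub>L A = A o\<^sub>L T" for T
  proof -
    have id: "T o\<^sub>L id_blinfun = T" "id_blinfun o\<^sub>L T = T" by (auto intro: blinfun_eqI)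
    have TB: "T o\<^sub>L B = B o\<^sub>L T"
      using T by (simp add: B_def compose_diff_left compose_diff_right id)
    have "T o\<^sub>L sqrt_iterate B n = sqrt_iterate B n o\<^sub>L T" for n
    proof (induction n)
      case 0
      then show ?case by (auto intro: blinfun_eqI)
    next
      case (Suc n)
      have "T o\<^sub>L (sqrt_iterate B n o\<^sub>L sqrt_iterate B n) = (sqrt_iterate B n o\<^sub>L sqrt_iterate B n) o\<^sub>L T"
        by (simp only: compose_assoc Suc) (simp only: compose_assoc[symmetric] Suc)
      then show ?case
        by (simp add: compose_scaleR_left compose_scaleR_right compose_add_left compose_add_right TB)
    qed
    moreover have "(\<lambda>n. (T o\<^sub>L sqrt_iterate B n)) \<longlonglongrightarrow> (T o\<^sub>L Y)"
      "(\<lambda>n. sqrt_iterate B n o\<^sub>L T) \<longlonglongrightarrow> (Y o\<^sub>L T)"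
      by (intro compose_tendsto tendsto_const Y)+
    ultimately have "T o\<^sub>L Y = Y o\<^sub>L T" using LIMSEQ_unique by simp
    then show ?thesis by (simp add: S_def compose_diff_left compose_diff_right id)
  qed
  ultimately show ?thesis using that by blast
qed

lemma psd_op_scaleR: "psd_op A \<Longrightarrow> r \<ge> 0 \<Longrightarrow> psd_op (r *\<^sub>R A)"
  unfolding psd_op_def symmetric_op_def by (auto simp: blinfun.scaleR_left)

text \<open>
  The square root commutes with the commutant of the operator; this is what gives
  uniqueness below and complex linearity later.
\<close>

lemma ex_psd_sqrt:
  fixes A :: "'a::{real_inner,banach} \<Rightarrow>\<^sub>L 'a"
  assumes A: "psd_op A"
  obtains S where "psd_op S" "S o\<^sub>L S = A" "\<And>T. T o\<^sub>L A = A o\<^sub>L T \<Longrightarrow> T o\<^sub>L S = S o\<^sub>L T"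
proof -
  define K where "K = norm A + 1"
  have K: "K > 0" by (simp add: K_def add_nonneg_pos)
  define A' where "A' = (1/K) *\<^sub>R A"
  have A': "A = K *\<^sub>R A'" using K by (simp add: A'_def)
  have "psd_op A'" unfolding A'_def using A K by (intro psd_op_scaleR) auto
  moreover have "inner (A' x) x \<le> (norm x)\<^sup>2" for x
  proof -
    have "inner (A x) x \<le> norm (A x) * norm x" by (rule norm_cauchy_schwarz)
    also have "\<dots> \<le> (norm A * norm x) * norm x" by (intro mult_right_mono norm_blinfun) auto
    also have "\<dots> \<le> (K * norm x) * norm x" by (intro mult_right_mono) (auto simp: K_def)
    finally show ?thesis using K by (simp add: A'_def blinfun.scaleR_left field_simps power2_eq_square)
  qed
  ultimately obtain S where S: "psd_op S" "S o\<^sub>L S = A'"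
      "\<And>T. T o\<^sub>L A' = A' o\<^sub>L T \<Longrightarrow> T o\<^sub>L S = S o\<^sub>L T"
    by (rule ex_psd_sqrt_contraction) blast
  show ?thesis
  proof (rule that[of "sqrt K *\<^sub>R S"])
    show "psd_op (sqrt K *\<^sub>R S)" using S(1) K by (intro psd_op_scaleR) auto
    show "sqrt K *\<^sub>R S o\<^sub>L sqrt K *\<^sub>R S = A"
      using K by (simp add: compose_scaleR_left compose_scaleR_right S(2) A')
    show "T o\<^sub>L sqrt K *\<^sub>R S = sqrt K *\<^sub>R S o\<^sub>L T" if "T o\<^sub>L A = A o\<^sub>L T" for T
    proof -
      have "T o\<^sub>L A' = A' o\<^sub>L T"
        using that by (simp add: A'_def compose_scaleR_left compose_scaleR_right)
      then show ?thesis by (simp add: compose_scaleR_left compose_scaleR_right S(3))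
    qed
  qed
qed

lemma psd_sqrt_unique:
  fixes R S :: "'a::{real_inner,banach} \<Rightarrow>\<^sub>L 'a"
  assumes R: "psd_op R" and S: "psd_op S" and sq: "R o\<^sub>L R = S o\<^sub>L S" and comm: "R o\<^sub>L S = S o\<^sub>L R"
  shows "R = S"
proof (rule blinfun_eqI)
  fix x
  define d where "d = R x - S x"
  \<comment> \<open>\<open>(R + S) (R - S) = R\<^sup>2 - S\<^sup>2 = 0\<close>, since \<open>R\<close> and \<open>S\<close> commute.\<close>
  have "R (R u) = S (S u)" "R (S u) = S (R u)" for u
    using sq comm by (metis blinfun_apply_blinfun_compose)+
  then have "R d + S d = 0" by (simp add: d_def blinfun.diff_right)
  then have "inner (R d) d + inner (S d) d = 0"
    by (metis inner_add_left inner_zero_left)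
  moreover have "inner (R d) d \<ge> 0" "inner (S d) d \<ge> 0" using R S by (auto simp: psd_op_def)
  ultimately have "inner (R d) d = 0" "inner (S d) d = 0" by linarith+
  then have "R d = 0" "S d = 0" using psd_op_zero R S by blast+
  moreover have "inner (R x - S x) d = inner x (R d - S d)"
    using R S by (simp add: psd_op_def symmetric_op_def inner_diff)
  ultimately have "inner d d = 0" by (simp add: d_def)
  then show "R x = S x" by (simp add: d_def)
qed


section \<open>Complex operators, adjoints and compressions\<close>

lemma inner_scaleC_i_left: "inner (\<i> *\<^sub>C x) y = - Im (cinner x y)"
  for x y :: "'a::chilbert_space"
  by (simp flip: Re_cinner add: cinner_scaleC_left)

lemma inner_scaleC_i_right: "inner x (\<i> *\<^sub>C y) = Im (cinner x y)"
  for x y :: "'a::chilbert_space"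
  using inner_scaleC_i_left[of y x] cinner_commute[of x y] by (simp add: inner_commute)

lemma inner_scaleC_i: "inner (\<i> *\<^sub>C x) y = - inner x (\<i> *\<^sub>C y)"
  for x y :: "'a::chilbert_space"
  by (simp add: inner_scaleC_i_left inner_scaleC_i_right)

lemma cinner_eq: "cinner x y = Complex (inner x y) (inner x (\<i> *\<^sub>C y))"
  for x y :: "'a::chilbert_space"
  by (simp add: complex_eq_iff Re_cinner inner_scaleC_i_right)

lemma scaleC_i_i: "\<i> *\<^sub>C \<i> *\<^sub>C x = - x"
  for x :: "'a::chilbert_space"
  using scaleC_complex_of_real[of "-1" x] by (simp add: scaleC_scaleC)

lemma scaleC_expand: "a *\<^sub>C x = Re a *\<^sub>R x + Im a *\<^sub>R (\<i> *\<^sub>C x)"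
  for x :: "'a::chilbert_space"
proof -
  have "a = complex_of_real (Re a) + complex_of_real (Im a) * \<i>"
    by (simp add: complex_eq_iff)
  then have "a *\<^sub>C x = (complex_of_real (Re a) + complex_of_real (Im a) * \<i>) *\<^sub>C x"
    by (rule arg_cong)
  then show ?thesis
    by (simp only: scaleC_add_left scaleC_scaleC[symmetric] scaleC_complex_of_real)
qed

lemma bounded_linear_scaleC_i: "bounded_linear (\<lambda>x::'a::chilbert_space. \<i> *\<^sub>C x)"
proof (rule bounded_linear_intro[of _ 1])
  fix x y :: 'a and r :: real
  show "\<i> *\<^sub>C (x + y) = \<i> *\<^sub>C x + \<i> *\<^sub>C y" by (rule scaleC_add_right)
  show "\<i> *\<^sub>C (r *\<^sub>R x) = r *\<^sub>R (\<i> *\<^sub>C x)"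
    by (simp only: scaleC_complex_of_real[symmetric] scaleC_scaleC mult.commute)
  have "(norm (\<i> *\<^sub>C x))\<^sup>2 = (norm x)\<^sup>2"
    by (simp add: power2_norm_eq_inner inner_scaleC_i scaleC_i_i)
  then show "norm (\<i> *\<^sub>C x) \<le> norm x * 1" by simp
qed

lemma scaleC_i_diff: "\<i> *\<^sub>C (x - y) = \<i> *\<^sub>C x - \<i> *\<^sub>C y"
  for x y :: "'a::chilbert_space"
  by (rule linear_diff[OF bounded_linear.linear[OF bounded_linear_scaleC_i]])

lemma scaleC_i_scaleR: "\<i> *\<^sub>C (r *\<^sub>R x) = r *\<^sub>R (\<i> *\<^sub>C x)"
  for x :: "'a::chilbert_space"
  by (rule linear_scale[OF bounded_linear.linear[OF bounded_linear_scaleC_i]])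

lemma scaleC_i_zero: "\<i> *\<^sub>C 0 = (0 :: 'a::chilbert_space)"
  by (rule linear_0[OF bounded_linear.linear[OF bounded_linear_scaleC_i]])

lemma bounded_ops_iff: "A \<in> bounded_ops \<longleftrightarrow> (\<forall>x. A (\<i> *\<^sub>C x) = \<i> *\<^sub>C A x)"
proof
  assume i: "\<forall>x. A (\<i> *\<^sub>C x) = \<i> *\<^sub>C A x"
  have "A (a *\<^sub>C x) = a *\<^sub>C A x" for a x
    unfolding scaleC_expand[of a] by (simp add: blinfun.add_right blinfun.scaleR_right i)
  then show "A \<in> bounded_ops" by (simp add: bounded_ops_def)
qed (simp add: bounded_ops_def)

lemma bounded_ops_commute_i: "A \<in> bounded_ops \<Longrightarrow> A (\<i> *\<^sub>C x) = \<i> *\<^sub>C A x"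
  by (simp add: bounded_ops_iff)

lemma bounded_ops_compose: "A \<in> bounded_ops \<Longrightarrow> B \<in> bounded_ops \<Longrightarrow> A o\<^sub>L B \<in> bounded_ops"
  by (simp add: bounded_ops_iff)

lemma cinner_self_adjoint_nonneg_iff:
  assumes "A \<in> bounded_ops" "symmetric_op A"
  shows "cinner (A x) x \<in> \<real>\<^sub>\<ge>\<^sub>0 \<longleftrightarrow> inner (A x) x \<ge> 0"
proof -
  have "inner (A x) (\<i> *\<^sub>C x) = inner x (\<i> *\<^sub>C A x)"
    using assms by (simp add: symmetric_op_def bounded_ops_commute_i)
  also have "\<dots> = - inner (A x) (\<i> *\<^sub>C x)"
    using inner_scaleC_i[of x "A x"] by (simp add: inner_commute)
  finally show ?thesis by (simp add: cinner_eq complex_nonneg_Reals_iff)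
qed

lemma op_le_on_iff:
  assumes "A \<in> bounded_ops" "symmetric_op A" "B \<in> bounded_ops" "symmetric_op B"
  shows "op_le_on S A B \<longleftrightarrow> (\<forall>x\<in>S. inner (A x) x \<le> inner (B x) x)"
proof -
  have "B - A \<in> bounded_ops"
    using assms by (simp add: bounded_ops_iff blinfun.diff_left scaleC_i_diff)
  moreover have "symmetric_op (B - A)"
    using assms by (simp add: symmetric_op_def blinfun.diff_left inner_diff)
  ultimately have "cinner ((B - A) x) x \<in> \<real>\<^sub>\<ge>\<^sub>0 \<longleftrightarrow> inner ((B - A) x) x \<ge> 0" for x
    by (rule cinner_self_adjoint_nonneg_iff)
  then show ?thesis
    by (simp add: op_le_on_def) (simp add: blinfun.diff_left inner_diff_left)
qed

text \<open>
  Over the complex numbers positivity of the quadratic form implies symmetry.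
\<close>

lemma positive_ops_iff: "A \<in> positive_ops \<longleftrightarrow> A \<in> bounded_ops \<and> psd_op A"
proof
  assume A: "A \<in> positive_ops"
  then have bd: "A \<in> bounded_ops" by (simp add: positive_ops_def)
  have "cinner (A x) x \<in> \<real>\<^sub>\<ge>\<^sub>0" for x
    using A by (simp add: positive_ops_def op_le_on_def)
  then have pos: "inner (A x) x \<ge> 0" and real: "inner (A x) (\<i> *\<^sub>C x) = 0" for x
    by (simp_all add: cinner_eq complex_nonneg_Reals_iff)
  \<comment> \<open>The quadratic form has vanishing imaginary part; polarize.\<close>
  have pol: "inner (A x) (\<i> *\<^sub>C y) + inner (A y) (\<i> *\<^sub>C x) = 0" for x y
    using real[of "x + y"] real[of x] real[of y]
    by (simp add: blinfun.add_right scaleC_add_right inner_add)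
  have "inner (A x) y = inner x (A y)" for x y
    using pol[of x "\<i> *\<^sub>C y"] bounded_ops_commute_i[OF bd] inner_scaleC_i[of "A y" "\<i> *\<^sub>C x"]
    by (simp add: scaleC_i_i inner_commute)
  then show "A \<in> bounded_ops \<and> psd_op A"
    using bd pos by (simp add: psd_op_def symmetric_op_def)
next
  assume "A \<in> bounded_ops \<and> psd_op A"
  then show "A \<in> positive_ops"
    by (simp add: positive_ops_def psd_op_def op_le_on_def cinner_self_adjoint_nonneg_iff)
qed

lemma positive_opsD:
  assumes "A \<in> positive_ops"
  shows "A \<in> bounded_ops" "inner (A x) y = inner x (A y)" "inner (A x) x \<ge> 0"
  using assms unfolding positive_ops_iff psd_op_def symmetric_op_def by blast+

lemma cadjoint_bounded_ops:
  assumes A: "A \<in> bounded_ops"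
  shows "cadjoint A \<in> bounded_ops" "inner (A x) y = inner x (cadjoint A y)"
proof -
  obtain B :: "'a \<Rightarrow>\<^sub>L 'a" where B: "\<And>x y. inner (A x) y = inner x (B y)"
    by (rule ex_adjoint[of A]) blast
  have i: "B (\<i> *\<^sub>C y) = \<i> *\<^sub>C B y" for y
  proof (rule inner_cancel_right)
    fix x
    have "inner x (B (\<i> *\<^sub>C y)) = - inner (\<i> *\<^sub>C A x) y" by (simp add: B[symmetric] inner_scaleC_i)
    also have "\<dots> = - inner (\<i> *\<^sub>C x) (B y)" by (simp add: B[symmetric] bounded_ops_commute_i[OF A])
    finally show "inner x (B (\<i> *\<^sub>C y)) = inner x (\<i> *\<^sub>C B y)" by (simp add: inner_scaleC_i)
  qed
  have "cadjoint A = B"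
    unfolding cadjoint_def
  proof (rule the_equality)
    show "\<forall>x y. cinner (A x) y = cinner x (B y)"
      by (simp add: cinner_eq B i)
  next
    fix C :: "'a \<Rightarrow>\<^sub>L 'a" assume C: "\<forall>x y. cinner (A x) y = cinner x (blinfun_apply C y)"
    show "C = B"
    proof (rule blinfun_eqI, rule inner_cancel_right)
      show "inner x (blinfun_apply C y) = inner x (B y)" for x y
        using C by (metis Re_cinner B)
    qed
  qed
  then show "cadjoint A \<in> bounded_ops" "inner (A x) y = inner x (cadjoint A y)"
    using i B by (simp_all add: bounded_ops_iff)
qed

lemma cadjoint_eq_self_iff:
  assumes "A \<in> bounded_ops"
  shows "cadjoint A = A \<longleftrightarrow> symmetric_op A"
proof
  assume "symmetric_op A"
  then have "inner x (cadjoint A y) = inner x (A y)" for x y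
    using cadjoint_bounded_ops(2)[OF assms] by (simp add: symmetric_op_def)
  then have "cadjoint A y = A y" for y by (rule inner_cancel_right)
  then show "cadjoint A = A" by (rule blinfun_eqI)
next
  assume "cadjoint A = A"
  then show "symmetric_op A"
    using cadjoint_bounded_ops(2)[OF assms] by (simp add: symmetric_op_def)
qed

lemma op_sqrt_positive:
  assumes A: "A \<in> positive_ops"
  shows "op_sqrt A \<in> positive_ops" "op_sqrt A o\<^sub>L op_sqrt A = A"
proof -
  have psd: "psd_op A" and bd: "A \<in> bounded_ops" using A by (auto simp: positive_ops_iff)
  obtain S where S: "psd_op S" "S o\<^sub>L S = A" and comm: "\<And>T. T o\<^sub>L A = A o\<^sub>L T \<Longrightarrow> T o\<^sub>L S = S o\<^sub>L T"
    by (rule ex_psd_sqrt[OF psd]) blast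
  \<comment> \<open>Multiplication by \<open>\<i>\<close> as a real operator; commuting with it is complex linearity.\<close>
  define J :: "'a \<Rightarrow>\<^sub>L 'a" where "J = Blinfun (\<lambda>x. \<i> *\<^sub>C x)"
  have J: "J x = \<i> *\<^sub>C x" for x
    by (simp add: J_def bounded_linear_Blinfun_apply bounded_linear_scaleC_i)
  have "J o\<^sub>L A = A o\<^sub>L J"
    by (rule blinfun_eqI) (simp add: J bounded_ops_commute_i[OF bd])
  then have "J o\<^sub>L S = S o\<^sub>L J" by (rule comm)
  then have "S (\<i> *\<^sub>C x) = \<i> *\<^sub>C S x" for x
    by (metis J blinfun_apply_blinfun_compose)
  then have pos: "S \<in> positive_ops" using S by (simp add: positive_ops_iff bounded_ops_iff)
  have "op_sqrt A = S"
    unfolding op_sqrt_def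
  proof (rule the_equality)
    fix R assume R: "R \<in> positive_ops \<and> R o\<^sub>L R = A"
    then have "R o\<^sub>L A = A o\<^sub>L R" using compose_assoc[of R R R] by simp
    then have "R o\<^sub>L S = S o\<^sub>L R" by (rule comm)
    moreover have "psd_op R" "R o\<^sub>L R = S o\<^sub>L S" using R S(2) by (simp_all add: positive_ops_iff)
    ultimately show "R = S" using psd_sqrt_unique S(1) by blast
  qed (use pos S in simp)
  then show "op_sqrt A \<in> positive_ops" "op_sqrt A o\<^sub>L op_sqrt A = A" using pos S by simp_all
qed

lemma norm_op_sqrt:
  assumes "A \<in> positive_ops"
  shows "(norm (op_sqrt A x))\<^sup>2 = inner (A x) x"
proof -
  have "inner (op_sqrt A (op_sqrt A x)) x = inner (op_sqrt A x) (op_sqrt A x)"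
    using op_sqrt_positive(1)[OF assms] by (simp add: positive_ops_iff psd_op_def symmetric_op_def)
  moreover have "op_sqrt A (op_sqrt A x) = A x"
    using op_sqrt_positive(2)[OF assms] by (metis blinfun_apply_blinfun_compose)
  ultimately show ?thesis by (simp add: power2_norm_eq_inner)
qed

lemma linear_blinfun_apply: "linear (blinfun_apply A)"
  by (simp add: bounded_linear.linear blinfun.bounded_linear_right)

text \<open>
  The range of a complex-linear operator is invariant under multiplication by \<open>\<i>\<close>, so real and complex
  orthogonality to it coincide.
\<close>

lemma cinner_orthogonal_closure_range_iff:
  assumes R: "R \<in> bounded_ops"
  shows "(\<forall>y\<in>closure (range R). cinner x y = 0) \<longleftrightarrow> (\<forall>h. inner (R h) x = 0)"
proof
  assume "\<forall>y\<in>closure (range R). cinner x y = 0"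
  then have "cinner x (R h) = 0" for h by (meson closure_subset rangeI subsetD)
  then show "\<forall>h. inner (R h) x = 0" by (metis Re_cinner inner_commute zero_complex.sel(1))
next
  assume 0: "\<forall>h. inner (R h) x = 0"
  then have "inner (R h) (\<i> *\<^sub>C x) = 0" for h
    using inner_scaleC_i[of "R h" x] bounded_ops_commute_i[OF R, of h] by (metis neg_equal_0_iff_equal)
  then have "inner y x = 0 \<and> inner y (\<i> *\<^sub>C x) = 0" if "y \<in> closure (range R)" for y
    using 0 in_closure_range_iff[OF linear_blinfun_apply] that by blast
  then show "\<forall>y\<in>closure (range R). cinner x y = 0"
    by (metis cinner_eq complex_eq_iff inner_commute inner_scaleC_i minus_zero complex.sel zero_complex.sel)
qed

lemma bounded_ops_between_closure_range_iff:
  assumes "R \<in> bounded_ops"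
  shows "A \<in> bounded_ops_between (closure (range R)) T \<longleftrightarrow>
    A \<in> bounded_ops \<and> range A \<subseteq> T \<and> (\<forall>x. (\<forall>h. inner (R h) x = 0) \<longrightarrow> A x = 0)"
  unfolding bounded_ops_between_def cinner_orthogonal_closure_range_iff[OF assms] by auto

lemma ex1_range_contraction:
  assumes R: "R \<in> bounded_ops" and S: "S \<in> bounded_ops" and K: "K \<ge> 0"
    and le: "\<And>h. norm (S h) \<le> K * norm (R h)"
  shows "\<exists>!C. C \<in> bounded_ops_between (closure (range R)) (closure (range S)) \<and> norm C \<le> K \<and>
    (\<forall>h. C (R h) = S h)"
proof (rule ex_ex1I)
  obtain C where C: "\<And>h. blinfun_apply C (R h) = S h" "\<And>x. (\<forall>h. inner (R h) x = 0) \<Longrightarrow> C x = 0"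
      "norm C \<le> K" "range C \<subseteq> closure (range S)"
    by (rule ex_range_factor[OF linear_blinfun_apply linear_blinfun_apply le K]) blast
  \<comment> \<open>Multiplication by \<open>\<i>\<close> as a real operator; commuting with it is complex linearity.\<close>
  define J :: "'a \<Rightarrow>\<^sub>L 'a" where "J = Blinfun (\<lambda>x. \<i> *\<^sub>C x)"
  have J: "J x = \<i> *\<^sub>C x" for x
    by (simp add: J_def bounded_linear_Blinfun_apply bounded_linear_scaleC_i)
  have "C o\<^sub>L J = J o\<^sub>L C"
  proof (rule blinfun_eq_on_range[OF linear_blinfun_apply[of R]])
    show "(C o\<^sub>L J) (R h) = (J o\<^sub>L C) (R h)" for h
      using C(1) R S by (simp add: J bounded_ops_commute_i[symmetric])
    show "(C o\<^sub>L J) x = (J o\<^sub>L C) x" if 0: "\<forall>h. inner (R h) x = 0" for x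
    proof -
      have "\<forall>h. inner (R h) (\<i> *\<^sub>C x) = 0"
        using 0 inner_scaleC_i[of _ x] bounded_ops_commute_i[OF R] by (metis neg_equal_0_iff_equal)
      then have "C (J x) = 0" by (simp add: J C(2))
      then show ?thesis using C(2)[OF 0] by (simp add: blinfun.zero_right)
    qed
  qed
  then have "C \<in> bounded_ops"
    unfolding bounded_ops_iff by (metis J blinfun_apply_blinfun_compose)
  then show "\<exists>C. C \<in> bounded_ops_between (closure (range R)) (closure (range S)) \<and> norm C \<le> K \<and>
      (\<forall>h. blinfun_apply C (R h) = S h)"
    using C by (auto simp: bounded_ops_between_closure_range_iff[OF R])
next
  fix C D
  assume "C \<in> bounded_ops_between (closure (range R)) (closure (range S)) \<and> norm C \<le> K \<and>
      (\<forall>h. blinfun_apply C (R h) = S h)"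
    "D \<in> bounded_ops_between (closure (range R)) (closure (range S)) \<and> norm D \<le> K \<and>
      (\<forall>h. blinfun_apply D (R h) = S h)"
  then show "C = D"
    by (intro blinfun_eq_on_range[OF linear_blinfun_apply[of R]])
       (auto simp: bounded_ops_between_closure_range_iff[OF R])
qed

lemma cadjoint_range_subset:
  assumes R: "R \<in> bounded_ops" and C: "C \<in> bounded_ops_between (closure (range R)) T"
  shows "range (cadjoint C) \<subseteq> closure (range R)"
proof
  fix z assume "z \<in> range (cadjoint C)"
  then obtain y where z: "z = cadjoint C y" by blast
  have C': "C \<in> bounded_ops" "\<And>x. (\<forall>h. inner (R h) x = 0) \<Longrightarrow> C x = 0"
    using C by (auto simp: bounded_ops_between_closure_range_iff[OF R])
  show "z \<in> closure (range R)"
    unfolding in_closure_range_iff[OF linear_blinfun_apply]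
  proof (intro allI impI)
    fix x assume "\<forall>h. inner (R h) x = 0"
    then have "C x = 0" by (rule C'(2))
    then have "inner x z = 0" using cadjoint_bounded_ops(2)[OF C'(1), of x y] by (simp add: z)
    then show "inner z x = 0" by (simp add: inner_commute)
  qed
qed

text \<open>
  If \<open>G \<le> c R\<^sup>2\<close>, the square root of \<open>G\<close> factors as \<open>C R\<close>, and \<open>X\<close> is the product of the adjoint
  of \<open>C\<close> and \<open>C\<close>.
\<close>

lemma ex_compression:
  assumes R: "R \<in> positive_ops" and G: "G \<in> positive_ops" and c: "c \<ge> 0"
    and le: "\<And>h. inner (G h) h \<le> c * (norm (R h))\<^sup>2"
  obtains X where "X \<in> bounded_ops_between (closure (range R)) (closure (range R))"
    "R o\<^sub>L X o\<^sub>L R = G" "psd_op X" "\<And>x. inner (X x) x \<le> c * (norm x)\<^sup>2" "norm X \<le> c"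
proof -
  let ?S = "op_sqrt G"
  have Rb: "R \<in> bounded_ops" and Rs: "inner (R x) y = inner x (R y)" for x y
    using positive_opsD[OF R] by blast+
  have Sb: "?S \<in> bounded_ops" and Ss: "inner (?S x) y = inner x (?S y)" for x y
    using positive_opsD[OF op_sqrt_positive(1)[OF G]] by blast+
  have SS: "?S (?S x) = G x" for x
    using op_sqrt_positive(2)[OF G] by (metis blinfun_apply_blinfun_compose)
  have "norm (?S h) \<le> sqrt c * norm (R h)" for h
  proof (rule power2_le_imp_le)
    show "(norm (?S h))\<^sup>2 \<le> (sqrt c * norm (R h))\<^sup>2"
      using le c by (simp add: norm_op_sqrt[OF G] power_mult_distrib)
  qed (use c in simp)
  then have "\<exists>!C. C \<in> bounded_ops_between (closure (range R)) (closure (range ?S)) \<and> norm C \<le> sqrt c \<and>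
      (\<forall>h. blinfun_apply C (R h) = ?S h)"
    by (intro ex1_range_contraction) (use Rb Sb c in auto)
  then obtain C where C: "C \<in> bounded_ops_between (closure (range R)) (closure (range ?S))"
      "norm C \<le> sqrt c" "\<And>h. blinfun_apply C (R h) = ?S h" by blast
  have Cb: "C \<in> bounded_ops" and C0: "\<And>x. (\<forall>h. inner (R h) x = 0) \<Longrightarrow> C x = 0"
    using C(1) by (auto simp: bounded_ops_between_closure_range_iff[OF Rb])
  define X where "X = cadjoint C o\<^sub>L C"
  have inX: "inner (X x) y = inner (C x) (C y)" for x y
    using cadjoint_bounded_ops(2)[OF Cb, of y "C x"] by (simp add: X_def inner_commute)
  have C_le: "norm (C x) \<le> sqrt c * norm x" for x
    using norm_blinfun[of C x] mult_right_mono[OF C(2), of "norm x"] by simp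
  have le_c: "inner (X x) x \<le> c * (norm x)\<^sup>2" for x
  proof -
    have "(norm (C x))\<^sup>2 \<le> (sqrt c * norm x)\<^sup>2" using C_le by (intro power_mono) auto
    then show ?thesis using c by (simp add: inX power2_norm_eq_inner power_mult_distrib)
  qed
  show ?thesis
  proof (rule that[of X])
    show "X \<in> bounded_ops_between (closure (range R)) (closure (range R))"
      unfolding bounded_ops_between_closure_range_iff[OF Rb]
      using cadjoint_range_subset[OF Rb C(1)] C0 Cb cadjoint_bounded_ops(1)[OF Cb]
      by (auto simp: X_def blinfun.zero_right bounded_ops_compose)
    show "R o\<^sub>L X o\<^sub>L R = G"
    proof (rule blinfun_eqI, rule inner_cancel_right)
      fix h k
      have "inner k ((R o\<^sub>L X o\<^sub>L R) h) = inner (X (R h)) (R k)"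
        by (simp add: Rs[symmetric] inner_commute)
      also have "\<dots> = inner k (G h)"
        by (simp add: inX C(3) Ss[symmetric] SS inner_commute[of k])
      finally show "inner k ((R o\<^sub>L X o\<^sub>L R) h) = inner k (G h)" .
    qed
    show "psd_op X" unfolding psd_op_def symmetric_op_def
      by (metis inX inner_commute inner_ge_zero)
    show "inner (X x) x \<le> c * (norm x)\<^sup>2" for x by (rule le_c)
    show "norm X \<le> c"
    proof (rule norm_blinfun_bound)
      fix x
      have "(norm (X x))\<^sup>2 = inner (C x) (C (X x))"
        by (simp add: power2_norm_eq_inner inX[symmetric])
      also have "\<dots> \<le> norm (C x) * norm (C (X x))" by (rule norm_cauchy_schwarz)
      also have "\<dots> \<le> (sqrt c * norm x) * (sqrt c * norm (X x))"
        using C_le c by (intro mult_mono) auto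
      also have "\<dots> = (c * norm x) * norm (X x)" using c by simp
      finally have "norm (X x) * norm (X x) \<le> (c * norm x) * norm (X x)"
        by (simp add: power2_eq_square)
      then show "norm (X x) \<le> c * norm x"
        using c by (cases "X x = 0") (auto simp: mult_le_cancel_right)
    qed (rule c)
  qed
qed

lemma compression_unique:
  assumes R: "R \<in> positive_ops"
    and X: "X \<in> bounded_ops_between (closure (range R)) (closure (range R))"
    and Y: "Y \<in> bounded_ops_between (closure (range R)) (closure (range R))"
    and eq: "R o\<^sub>L X o\<^sub>L R = R o\<^sub>L Y o\<^sub>L R"
  shows "X = Y"
proof -
  have Rb: "R \<in> bounded_ops" and Rs: "inner (R x) y = inner x (R y)" for x y
    using positive_opsD[OF R] by blast+
  note X' = X[unfolded bounded_ops_between_closure_range_iff[OF Rb]]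
  note Y' = Y[unfolded bounded_ops_between_closure_range_iff[OF Rb]]
  show ?thesis
  proof (rule blinfun_eq_on_range[OF linear_blinfun_apply[of R]])
    fix h
    have "X (R h) - Y (R h) = 0"
    proof (rule closure_range_unique[OF linear_blinfun_apply])
      show "X (R h) - Y (R h) \<in> closure (range R)"
        using X' Y' by (intro subspace_diff[OF subspace_closure_range[OF linear_blinfun_apply]]) auto
      have "R (X (R h)) = R (Y (R h))" using eq by (metis blinfun_apply_blinfun_compose)
      then show "inner (R k) (X (R h) - Y (R h)) = 0" for k
        by (simp add: Rs blinfun.diff_right)
    qed
    then show "X (R h) = Y (R h)" by simp
  qed (use X' Y' in auto)
qed


section \<open>Countably additive functions on the sequence space\<close>

text \<open>
  Countably additive real functions on the Borel sets. They may be signed, so that differences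
  and polarizations stay inside the class; finiteness is built in.
\<close>

definition sigma_additive :: "nat \<Rightarrow> ((nat \<Rightarrow> nat) set \<Rightarrow> real) \<Rightarrow> bool"
  where "sigma_additive m f \<longleftrightarrow>
    (\<forall>A. range A \<subseteq> sets (sequences m) \<longrightarrow> disjoint_family A \<longrightarrow>
      (\<lambda>n. f (A n)) sums f (\<Union>n. A n))"

lemma sigma_additiveD:
  "sigma_additive m f \<Longrightarrow> range A \<subseteq> sets (sequences m) \<Longrightarrow> disjoint_family A \<Longrightarrow>
    (\<lambda>n. f (A n)) sums f (\<Union>n. A n)"
  by (simp add: sigma_additive_def)

lemma sigma_additive_add:
  "sigma_additive m f \<Longrightarrow> sigma_additive m g \<Longrightarrow> sigma_additive m (\<lambda>B. f B + g B)"
  by (auto simp: sigma_additive_def intro!: sums_add)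

lemma sigma_additive_diff:
  "sigma_additive m f \<Longrightarrow> sigma_additive m g \<Longrightarrow> sigma_additive m (\<lambda>B. f B - g B)"
  by (auto simp: sigma_additive_def intro!: sums_diff)

lemma sigma_additive_mult: "sigma_additive m f \<Longrightarrow> sigma_additive m (\<lambda>B. r * f B)"
  by (auto simp: sigma_additive_def intro!: sums_mult)

lemma sigma_additive_sum:
  assumes "\<And>i. i \<in> I \<Longrightarrow> sigma_additive m (f i)"
  shows "sigma_additive m (\<lambda>B. \<Sum>i\<in>I. f i B)"
  using assms by (auto simp: sigma_additive_def intro!: sums_sum)

lemma sigma_additive_empty:
  assumes "sigma_additive m f"
  shows "f {} = 0"
proof -
  have "(\<lambda>n::nat. f {}) sums f {}"
    using sigma_additiveD[OF assms, of "\<lambda>_. {}"] by (simp add: disjoint_family_on_def)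
  then show ?thesis
    using summable_const_iff sums_summable by blast
qed

lemma sigma_additive_Un:
  assumes f: "sigma_additive m f" and "A \<in> sets (sequences m)" "B \<in> sets (sequences m)" "A \<inter> B = {}"
  shows "f (A \<union> B) = f A + f B"
proof -
  have "(\<lambda>n. f (binaryset A B n)) sums f (\<Union>n. binaryset A B n)"
    using assms by (intro sigma_additiveD[OF f])
      (auto simp: range_binaryset_eq disjoint_family_on_def binaryset_def)
  moreover have "(\<lambda>n. f (binaryset A B n)) sums (f A + f B)"
    by (rule binaryset_sums[of f, OF sigma_additive_empty[OF f]])
  ultimately show ?thesis using sums_unique2 by (simp add: UN_binaryset_eq) blast
qed

lemma sigma_additive_finite_UN:
  assumes f: "sigma_additive m f" and "finite I" "\<And>i. i \<in> I \<Longrightarrow> A i \<in> sets (sequences m)"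
    "disjoint_family_on A I"
  shows "f (\<Union>i\<in>I. A i) = (\<Sum>i\<in>I. f (A i))"
  using assms(2-)
proof (induction I rule: finite_induct)
  case empty
  then show ?case by (simp add: sigma_additive_empty[OF f])
next
  case (insert i I)
  have "f (A i \<union> (\<Union>i\<in>I. A i)) = f (A i) + f (\<Union>i\<in>I. A i)"
  proof (rule sigma_additive_Un[OF f])
    show "(\<Union>i\<in>I. A i) \<in> sets (sequences m)" using insert by (intro sets.finite_UN) auto
    show "A i \<inter> (\<Union>i\<in>I. A i) = {}"
      using insert(2) insert.prems(2) by (auto simp: disjoint_family_on_def)
  qed (use insert in auto)
  moreover have "f (\<Union>i\<in>I. A i) = (\<Sum>i\<in>I. f (A i))"
    using insert.prems by (intro insert.IH) (auto simp: disjoint_family_on_def)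
  ultimately show ?case using insert(1,2) by simp
qed

lemma sigma_additive_Int:
  assumes f: "sigma_additive m f" and C: "C \<in> sets (sequences m)"
  shows "sigma_additive m (\<lambda>B. f (B \<inter> C))"
  unfolding sigma_additive_def
proof (intro allI impI)
  fix A :: "nat \<Rightarrow> (nat \<Rightarrow> nat) set"
  assume "range A \<subseteq> sets (sequences m)" "disjoint_family A"
  then have "(\<lambda>n. f (A n \<inter> C)) sums f (\<Union>n. A n \<inter> C)"
    using C by (intro sigma_additiveD[OF f]) (auto simp: disjoint_family_on_def)
  then show "(\<lambda>n. f (A n \<inter> C)) sums f ((\<Union>n. A n) \<inter> C)" by simp
qed

lemma space_sequences: "space (sequences m) = {x. \<forall>i. x i < m}"
  by (auto simp: sequences_def space_PiM PiE_def Pi_def)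

lemma in_words_snoc: "w @ [j] \<in> words m \<longleftrightarrow> w \<in> words m \<and> j < m"
  by (auto simp: words_def)

lemma Nil_in_words: "[] \<in> words m"
  by (simp add: words_def)

lemma cylinder_Nil: "cylinder m [] = space (sequences m)"
  by (simp add: cylinder_def)

lemma cylinder_sets:
  assumes "w \<in> words m"
  shows "cylinder m w \<in> sets (sequences m)"
proof -
  have "{x \<in> space (sequences m). x i = w ! i} \<in> sets (sequences m)" if i: "i < length w" for i
  proof -
    have "w ! i < m" using assms nth_mem[OF i] by (auto simp: words_def)
    moreover have "(\<lambda>x. x i) \<in> sequences m \<rightarrow>\<^sub>M count_space {..<m}"
      unfolding sequences_def by (rule measurable_component_singleton) simp
    ultimately have "(\<lambda>x. x i) -` {w ! i} \<inter> space (sequences m) \<in> sets (sequences m)"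
      by (intro measurable_sets[of _ _ "count_space {..<m}"]) auto
    moreover have "(\<lambda>x. x i) -` {w ! i} \<inter> space (sequences m) = {x \<in> space (sequences m). x i = w ! i}"
      by auto
    ultimately show ?thesis by simp
  qed
  then have "{x \<in> space (sequences m). \<forall>i\<in>{..<length w}. x i = w ! i} \<in> sets (sequences m)"
    by (intro sets.sets_Collect_finite_All) auto
  moreover have "cylinder m w = {x \<in> space (sequences m). \<forall>i\<in>{..<length w}. x i = w ! i}"
    by (auto simp: cylinder_def)
  ultimately show ?thesis by simp
qed

lemma cylinder_snoc:
  "cylinder m (w @ [j]) = {x \<in> cylinder m w. x (length w) = j}"
  by (auto simp: cylinder_def nth_append less_Suc_eq)

lemma cylinder_append_subset: "cylinder m (v @ s) \<subseteq> cylinder m v"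
  by (auto simp: cylinder_def nth_append)

lemma cylinder_disjoint:
  "i < length v \<Longrightarrow> i < length w \<Longrightarrow> v ! i \<noteq> w ! i \<Longrightarrow> cylinder m v \<inter> cylinder m w = {}"
  by (auto simp: cylinder_def)

lemma cylinder_UN_snoc: "cylinder m w = (\<Union>j<m. cylinder m (w @ [j]))"
  by (auto simp: cylinder_snoc) (auto simp: cylinder_def space_sequences)

lemma sigma_additive_children:
  assumes f: "sigma_additive m f" and w: "w \<in> words m" and B: "B \<in> sets (sequences m)"
  shows "f (B \<inter> cylinder m w) = (\<Sum>j<m. f (B \<inter> cylinder m (w @ [j])))"
proof -
  have "B \<inter> cylinder m w = (\<Union>j<m. B \<inter> cylinder m (w @ [j]))"
    using cylinder_UN_snoc[of m w] by blast
  also have "f \<dots> = (\<Sum>j<m. f (B \<inter> cylinder m (w @ [j])))"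
  proof (rule sigma_additive_finite_UN[OF f])
    show "B \<inter> cylinder m (w @ [j]) \<in> sets (sequences m)" if "j \<in> {..<m}" for j
      using that w B by (intro sets.Int cylinder_sets) (auto simp: in_words_snoc)
    show "disjoint_family_on (\<lambda>j. B \<inter> cylinder m (w @ [j])) {..<m}"
      by (auto simp: disjoint_family_on_def cylinder_snoc)
  qed simp
  finally show ?thesis .
qed

lemma sigma_additive_cylinder:
  assumes "sigma_additive m f" "w \<in> words m"
  shows "f (cylinder m w) = (\<Sum>j<m. f (cylinder m (w @ [j])))"
proof -
  have Int: "space (sequences m) \<inter> cylinder m v = cylinder m v" for v
    by (rule Int_absorb1) (auto simp: cylinder_def)
  show ?thesis
    using sigma_additive_children[OF assms sets.top] unfolding Int .
qed

lemma sets_sequences_generated: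
  "sets (sequences m) = sigma_sets (space (sequences m)) (insert {} (cylinder m ` words m))"
proof
  show "sets (sequences m) \<subseteq> sigma_sets (space (sequences m)) (insert {} (cylinder m ` words m))"
    (is "_ \<subseteq> ?R")
  proof -
    have "{f \<in> \<Pi>\<^sub>E i\<in>UNIV. {..<m}. f i \<in> A} \<in> ?R" for i A
    proof -
      have "{f \<in> \<Pi>\<^sub>E i\<in>UNIV. {..<m}. f i \<in> A}
          = \<Union> (cylinder m ` {w \<in> words m. length w = Suc i \<and> w ! i \<in> A})"
      proof (intro equalityI subsetI)
        fix f assume "f \<in> {f \<in> \<Pi>\<^sub>E i\<in>UNIV. {..<m}. f i \<in> A}"
        then have f: "\<And>k. f k < m" "f i \<in> A" by auto
        let ?w = "map f [0..<Suc i]"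
        have "f \<in> cylinder m ?w"
          using f(1) by (auto simp: cylinder_def space_sequences simp del: upt_Suc)
        moreover have "?w \<in> {w \<in> words m. length w = Suc i \<and> w ! i \<in> A}"
          using f by (auto simp: words_def simp del: upt_Suc)
        ultimately show "f \<in> \<Union> (cylinder m ` {w \<in> words m. length w = Suc i \<and> w ! i \<in> A})"
          by blast
      next
        fix f assume "f \<in> \<Union> (cylinder m ` {w \<in> words m. length w = Suc i \<and> w ! i \<in> A})"
        then show "f \<in> {f \<in> \<Pi>\<^sub>E i\<in>UNIV. {..<m}. f i \<in> A}"
          by (auto simp: cylinder_def space_sequences)
      qed
      also have "\<dots> \<in> ?R"
        by (rule sigma_sets_UNION) auto
      finally show ?thesis .
    qed
    then show ?thesis
      unfolding sequences_def sets_PiM_single space_PiM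
      by (intro sigma_sets_mono) (auto simp: sequences_def space_PiM)
  qed
  show "sigma_sets (space (sequences m)) (insert {} (cylinder m ` words m)) \<subseteq> sets (sequences m)"
    by (intro sets.sigma_sets_subset) (auto intro: cylinder_sets)
qed

lemma Int_stable_cylinders: "Int_stable (insert {} (cylinder m ` words m))"
proof (rule Int_stableI)
  have comparable: "cylinder m v \<inter> cylinder m w \<in> {{}, cylinder m w}" if "length v \<le> length w" for v w
  proof (cases "\<exists>i<length v. v ! i \<noteq> w ! i")
    case True
    then obtain i where i: "i < length v" "v ! i \<noteq> w ! i" by blast
    then show ?thesis using that cylinder_disjoint[of i v w] by simp
  next
    case False
    then have "cylinder m w \<subseteq> cylinder m v" using that by (auto simp: cylinder_def)
    then show ?thesis by blast
  qed
  fix A B assume AB: "A \<in> insert {} (cylinder m ` words m)" "B \<in> insert {} (cylinder m ` words m)"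
  show "A \<inter> B \<in> insert {} (cylinder m ` words m)"
  proof (cases "A = {} \<or> B = {}")
    case False
    then obtain v w where vw: "A = cylinder m v" "v \<in> words m" "B = cylinder m w" "w \<in> words m"
      using AB by blast
    show ?thesis
      using comparable[of v w] comparable[of w v] vw
      by (cases "length v \<le> length w") (auto simp: Int_commute)
  qed auto
qed

text \<open>
  Dynkin class induction: the cylinders together with the empty set are closed under intersection and
  generate the Borel sets.
\<close>

lemma sequences_induct [consumes 1, case_names cylinder empty compl union]:
  assumes B: "B \<in> sets (sequences m)"
    and "\<And>w. w \<in> words m \<Longrightarrow> P (cylinder m w)"
    and "P {}"
    and "\<And>A. A \<in> sets (sequences m) \<Longrightarrow> P A \<Longrightarrow> P (space (sequences m) - A)"
    and "\<And>A :: nat \<Rightarrow> (nat \<Rightarrow> nat) set. disjoint_family A \<Longrightarrow> range A \<subseteq> sets (sequences m) \<Longrightarrow>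
           (\<And>i. P (A i)) \<Longrightarrow> P (\<Union>i. A i)"
  shows "P B"
proof (rule sigma_sets_induct_disjoint[OF Int_stable_cylinders, of m "space (sequences m)" B P])
  show "insert {} (cylinder m ` words m) \<subseteq> Pow (space (sequences m))"
    by (auto simp: cylinder_def)
qed (use assms in \<open>auto simp flip: sets_sequences_generated\<close>)

lemma sigma_additive_compl:
  assumes "sigma_additive m f" "B \<in> sets (sequences m)"
  shows "f (space (sequences m) - B) = f (cylinder m []) - f B"
proof -
  have "f (B \<union> (space (sequences m) - B)) = f B + f (space (sequences m) - B)"
    by (rule sigma_additive_Un[OF assms(1)]) (use assms in auto)
  moreover have "B \<union> (space (sequences m) - B) = space (sequences m)"
    using sets.sets_into_space[OF assms(2)] by blast
  ultimately show ?thesis by (simp add: cylinder_Nil)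
qed

lemma sigma_additive_eqI:
  assumes f: "sigma_additive m f" and g: "sigma_additive m g"
    and eq: "\<And>w. w \<in> words m \<Longrightarrow> f (cylinder m w) = g (cylinder m w)"
    and B: "B \<in> sets (sequences m)"
  shows "f B = g B"
  using B
proof (induction rule: sequences_induct)
  case (cylinder w)
  then show ?case by (rule eq)
next
  case empty
  then show ?case by (simp add: sigma_additive_empty[OF f] sigma_additive_empty[OF g])
next
  case (compl A)
  then show ?case
    by (simp add: sigma_additive_compl[OF f] sigma_additive_compl[OF g] eq Nil_in_words)
next
  case (union A)
  then show ?case
    using sigma_additiveD[OF f, of A] sigma_additiveD[OF g, of A] by (auto intro: sums_unique2)
qed

text \<open>
  The measure, restricted to the cylinder of \<open>w\<close>, that has \<open>\<mu>\<close>-density \<open>\<nu> v / \<mu> (cylinder m v)\<close> on the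
  cylinder of each extension \<open>v\<close> of \<open>w\<close> by \<open>n\<close> letters. Where \<open>\<mu> (cylinder m v) = 0\<close> the quotient is zero by
  convention, which is harmless when \<open>\<nu>\<close> is dominated by a multiple of \<open>\<mu>\<close>, as \<open>\<nu> v\<close> then vanishes too.
\<close>

primrec density_approx ::
    "nat \<Rightarrow> ((nat \<Rightarrow> nat) set \<Rightarrow> real) \<Rightarrow> (nat list \<Rightarrow> real) \<Rightarrow> nat \<Rightarrow> nat list \<Rightarrow> (nat \<Rightarrow> nat) set \<Rightarrow> real"
  where "density_approx m \<mu> \<nu> 0 w = (\<lambda>B. \<nu> w / \<mu> (cylinder m w) * \<mu> (B \<inter> cylinder m w))"
  | "density_approx m \<mu> \<nu> (Suc n) w = (\<lambda>B. \<Sum>j<m. density_approx m \<mu> \<nu> n (w @ [j]) B)"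

text \<open>
  An additive function on cylinders dominated by \<open>c \<mu>\<close> extends to a measure dominated by \<open>c \<mu>\<close>.
\<close>

lemma sigma_additive_extension:
  assumes \<mu>: "sigma_additive m \<mu>" and pos: "\<And>B. B \<in> sets (sequences m) \<Longrightarrow> \<mu> B \<ge> 0"
    and \<nu>0: "\<And>w. w \<in> words m \<Longrightarrow> 0 \<le> \<nu> w" and \<nu>c: "\<And>w. w \<in> words m \<Longrightarrow> \<nu> w \<le> c * \<mu> (cylinder m w)"
    and \<nu>: "\<And>w. w \<in> words m \<Longrightarrow> \<nu> w = (\<Sum>j<m. \<nu> (w @ [j]))"
  obtains N where "sigma_additive m N" "\<And>B. B \<in> sets (sequences m) \<Longrightarrow> 0 \<le> N B"
    "\<And>B. B \<in> sets (sequences m) \<Longrightarrow> N B \<le> c * \<mu> B" "\<And>w. w \<in> words m \<Longrightarrow> N (cylinder m w) = \<nu> w"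
proof -
  let ?g = "density_approx m \<mu> \<nu>"
  have add: "sigma_additive m (?g n w)" if "w \<in> words m" for n w
    using that
  proof (induction n arbitrary: w)
    case 0
    then show ?case
      unfolding density_approx.simps
      by (intro sigma_additive_mult sigma_additive_Int[OF \<mu>] cylinder_sets)
  next
    case (Suc n)
    then show ?case
      unfolding density_approx.simps by (intro sigma_additive_sum Suc.IH) (simp add: in_words_snoc)
  qed
  have bounds: "0 \<le> ?g n w B \<and> ?g n w B \<le> c * \<mu> (B \<inter> cylinder m w)"
    if "w \<in> words m" "B \<in> sets (sequences m)" for n w B
    using that
  proof (induction n arbitrary: w)
    case 0
    have p: "\<mu> (B \<inter> cylinder m w) \<ge> 0" "\<mu> (cylinder m w) \<ge> 0"
      using 0 by (auto intro!: pos sets.Int cylinder_sets)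
    have "\<mu> (B \<inter> cylinder m w) = 0" if z: "\<mu> (cylinder m w) = 0"
    proof -
      have "\<mu> ((B \<inter> cylinder m w) \<union> (cylinder m w - B)) = \<mu> (B \<inter> cylinder m w) + \<mu> (cylinder m w - B)"
        using 0 by (intro sigma_additive_Un[OF \<mu>]) (auto intro!: cylinder_sets)
      moreover have "(B \<inter> cylinder m w) \<union> (cylinder m w - B) = cylinder m w" by blast
      moreover have "\<mu> (cylinder m w - B) \<ge> 0" using 0 by (auto intro!: pos cylinder_sets)
      ultimately show ?thesis using z p by simp
    qed
    moreover have "\<nu> w / \<mu> (cylinder m w) \<le> c" if "\<mu> (cylinder m w) \<noteq> 0"
      using that p \<nu>c[OF 0(1)] by (simp add: divide_le_eq)
    ultimately have "\<nu> w / \<mu> (cylinder m w) * \<mu> (B \<inter> cylinder m w) \<le> c * \<mu> (B \<inter> cylinder m w)"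
      using p(1) by (cases "\<mu> (cylinder m w) = 0") (simp, intro mult_right_mono, auto)
    then show ?case using p \<nu>0[OF 0(1)] by simp
  next
    case (Suc n)
    then have IH: "0 \<le> ?g n (w @ [j]) B" "?g n (w @ [j]) B \<le> c * \<mu> (B \<inter> cylinder m (w @ [j]))"
      if "j < m" for j
      using that by (auto simp: in_words_snoc)
    show ?case
      unfolding density_approx.simps sigma_additive_children[OF \<mu> Suc.prems] sum_distrib_left
      using IH by (auto intro!: sum_nonneg sum_mono)
  qed
  \<comment> \<open>Additivity of \<open>\<nu>\<close> makes the approximations exact on all cylinders up to level \<open>n\<close>.\<close>
  have inside: "?g n w B = \<nu> w" if "w \<in> words m" "cylinder m w \<subseteq> B" for n w B
    using that
  proof (induction n arbitrary: w)
    case 0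
    have "B \<inter> cylinder m w = cylinder m w" using 0 by blast
    then show ?case
      using \<nu>0[OF 0(1)] \<nu>c[OF 0(1)] by auto
  next
    case (Suc n)
    have "?g n (w @ [j]) B = \<nu> (w @ [j])" if "j < m" for j
      using Suc that cylinder_append_subset[of m w "[j]"] by (intro Suc.IH) (auto simp: in_words_snoc)
    then show ?case using \<nu>[OF Suc.prems(1)] by simp
  qed
  have outside: "?g n w B = 0" if "w \<in> words m" "B \<in> sets (sequences m)" "B \<inter> cylinder m w = {}" for n w B
    using bounds[OF that(1,2), of n] that(3) by (simp add: sigma_additive_empty[OF \<mu>])
  have level: "?g (length s + n) w (cylinder m (w @ s)) = \<nu> (w @ s)" if "w @ s \<in> words m" for n w s
    using that
  proof (induction s arbitrary: w)
    case Nil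
    then show ?case using inside by simp
  next
    case (Cons a s)
    then have a: "a < m" and w: "w \<in> words m" by (auto simp: words_def)
    have "?g (length (a # s) + n) w (cylinder m (w @ a # s))
        = (\<Sum>j<m. ?g (length s + n) (w @ [j]) (cylinder m (w @ a # s)))" by simp
    also have "\<dots> = (\<Sum>j<m. if j = a then \<nu> (w @ a # s) else 0)"
    proof (rule sum.cong)
      fix j assume j: "j \<in> {..<m}"
      show "?g (length s + n) (w @ [j]) (cylinder m (w @ a # s)) = (if j = a then \<nu> (w @ a # s) else 0)"
      proof (cases "j = a")
        case True
        then show ?thesis using Cons.IH[of "w @ [a]"] Cons.prems by simp
      next
        case False
        then have "cylinder m (w @ a # s) \<inter> cylinder m (w @ [j]) = {}"
          by (intro cylinder_disjoint[of "length w"]) auto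
        then show ?thesis
          using False outside cylinder_sets[OF Cons.prems] w j by (simp add: in_words_snoc)
      qed
    qed simp
    finally show ?case using a by simp
  qed
  define L where "L B = lim (\<lambda>n. ?g n [] B)" for B
  have bounds': "0 \<le> ?g n [] B" "?g n [] B \<le> c * \<mu> B" if "B \<in> sets (sequences m)" for n B
  proof -
    have "B \<inter> cylinder m [] = B"
      using sets.sets_into_space[OF that] by (auto simp: cylinder_Nil)
    then show "0 \<le> ?g n [] B" "?g n [] B \<le> c * \<mu> B"
      using bounds[OF Nil_in_words that, of n] by simp_all
  qed
  have cyl: "(\<lambda>n. ?g n [] (cylinder m w)) \<longlonglongrightarrow> \<nu> w" if "w \<in> words m" for w
  proof (rule LIMSEQ_offset[of _ "length w"])
    show "(\<lambda>n. ?g (n + length w) [] (cylinder m w)) \<longlonglongrightarrow> \<nu> w"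
      using level[of "[]" w] that by (simp add: add.commute)
  qed
  \<comment> \<open>The bound \<open>c \<mu> (A k)\<close>, uniform in \<open>n\<close>, permits the exchange of limit and sum (Tannery).\<close>
  have unions: "summable (\<lambda>k. L (A k)) \<and> (\<lambda>n. ?g n [] (\<Union>k. A k)) \<longlonglongrightarrow> (\<Sum>k. L (A k))"
    if A: "range A \<subseteq> sets (sequences m)" "disjoint_family A"
      and lim: "\<And>k. (\<lambda>n. ?g n [] (A k)) \<longlonglongrightarrow> L (A k)" for A :: "nat \<Rightarrow> (nat \<Rightarrow> nat) set"
  proof -
    have sm: "summable (\<lambda>k. c * \<mu> (A k))"
      by (intro summable_mult sums_summable[OF sigma_additiveD[OF \<mu> A]])
    have "norm (?g n [] (A k)) \<le> c * \<mu> (A k)" for n k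
      using bounds'[of "A k" n] A(1) by auto
    then have bound: "\<forall>\<^sub>F (k, n) in at_top \<times>\<^sub>F sequentially. norm (?g n [] (A k)) \<le> c * \<mu> (A k)"
      by (intro always_eventually) auto
    have t: "summable (\<lambda>k. norm (L (A k)))"
        "(\<lambda>n. \<Sum>k. ?g n [] (A k)) \<longlonglongrightarrow> (\<Sum>k. L (A k))"
      using tannerys_theorem[OF lim bound sm] by simp_all
    have "(\<Sum>k. ?g n [] (A k)) = ?g n [] (\<Union>k. A k)" for n
      using sigma_additiveD[OF add[OF Nil_in_words] A] by (simp add: sums_iff)
    then show ?thesis using t(2) summable_norm_cancel[OF t(1)] by simp
  qed
  have lim: "(\<lambda>n. ?g n [] B) \<longlonglongrightarrow> L B" if "B \<in> sets (sequences m)" for B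
  proof -
    have "convergent (\<lambda>n. ?g n [] B)"
      using that
    proof (induction rule: sequences_induct)
      case (cylinder w)
      then show ?case using cyl by (auto simp: convergent_def)
    next
      case empty
      then show ?case
        using sigma_additive_empty[OF add[OF Nil_in_words]] by (simp add: convergent_const)
    next
      case (compl A)
      have "convergent (\<lambda>n. ?g n [] (cylinder m []))"
        using cyl[OF Nil_in_words] by (rule convergentI)
      then show ?case
        using compl by (simp add: sigma_additive_compl[OF add[OF Nil_in_words]] convergent_diff)
    next
      case (union A)
      then show ?case
        using unions[of A] unfolding L_def convergent_LIMSEQ_iff[symmetric]
        by (blast intro: convergentI)
    qed
    then show ?thesis by (simp add: L_def convergent_LIMSEQ_iff)
  qed
  show ?thesis
  proof (rule that[of L])
    show "sigma_additive m L"
      unfolding sigma_additive_def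
    proof (intro allI impI)
      fix A :: "nat \<Rightarrow> (nat \<Rightarrow> nat) set"
      assume A: "range A \<subseteq> sets (sequences m)" "disjoint_family A"
      then have u: "summable (\<lambda>k. L (A k))" "(\<lambda>n. ?g n [] (\<Union>k. A k)) \<longlonglongrightarrow> (\<Sum>k. L (A k))"
        using unions[OF A] lim by blast+
      have "(\<Union>k. A k) \<in> sets (sequences m)" using A by auto
      then have "L (\<Union>k. A k) = (\<Sum>k. L (A k))" using LIMSEQ_unique[OF lim u(2)] by simp
      then show "(\<lambda>n. L (A n)) sums L (\<Union>n. A n)" using u(1) by (simp add: sums_iff)
    qed
    show "0 \<le> L B" if "B \<in> sets (sequences m)" for B
      using bounds'(1)[OF that] by (intro LIMSEQ_le_const[OF lim[OF that]]) auto
    show "L B \<le> c * \<mu> B" if "B \<in> sets (sequences m)" for B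
      using bounds'(2)[OF that] by (intro LIMSEQ_le_const2[OF lim[OF that]]) auto
    show "L (cylinder m w) = \<nu> w" if "w \<in> words m" for w
      using LIMSEQ_unique[OF lim[OF cylinder_sets[OF that]] cyl[OF that]] .
  qed
qed


section \<open>Extension of operator families from cylinders\<close>

lemma positive_op_measuresD:
  assumes F: "F \<in> positive_op_measures m"
  shows "B \<in> sets (sequences m) \<Longrightarrow> F B \<in> positive_ops"
    and "sigma_additive m (\<lambda>B. inner (F B h) k)"
proof -
  show "B \<in> sets (sequences m) \<Longrightarrow> F B \<in> positive_ops"
    using F by (auto simp: positive_op_measures_def)
  show "sigma_additive m (\<lambda>B. inner (F B h) k)"
    unfolding sigma_additive_def
  proof (intro allI impI)
    fix A :: "nat \<Rightarrow> (nat \<Rightarrow> nat) set"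
    assume A: "range A \<subseteq> sets (sequences m)" "disjoint_family A"
    then have "(\<lambda>n. cinner (F (A n) h) k) sums cinner (F (\<Union>n. A n) h) k"
      using F unfolding positive_op_measures_def by blast
    then show "(\<lambda>n. inner (F (A n) h) k) sums inner (F (\<Union>n. A n) h) k"
      by (simp add: sums_complex_iff Re_cinner)
  qed
qed

lemma positive_op_measuresI:
  assumes "F \<in> sets (sequences m) \<rightarrow>\<^sub>E positive_ops"
    and add: "\<And>h k. sigma_additive m (\<lambda>B. inner (F B h) k)"
  shows "F \<in> positive_op_measures m"
proof -
  have "(\<lambda>n. cinner (F (A n) h) k) sums cinner (F (\<Union>n. A n) h) k"
    if "range A \<subseteq> sets (sequences m)" "disjoint_family A" for A h k
    unfolding sums_complex_iff
    using sigma_additiveD[OF add that, of h k] sigma_additiveD[OF add that, of h "\<i> *\<^sub>C k"]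
    by (simp add: Re_cinner inner_scaleC_i_right)
  then show ?thesis using assms(1) by (simp add: positive_op_measures_def)
qed

lemma blinfun_eq_inner:
  fixes A B :: "'a::real_inner \<Rightarrow>\<^sub>L 'a"
  assumes "\<And>h k. inner (A h) k = inner (B h) k"
  shows "A = B"
proof (rule blinfun_eqI)
  fix h
  have "inner k (A h) = inner k (B h)" for k
    using assms[of h k] by (simp only: inner_commute[of k])
  then show "A h = B h" by (rule inner_cancel_right)
qed

lemma positive_op_measures_eqI:
  assumes F: "F \<in> positive_op_measures m" and G: "G \<in> positive_op_measures m"
    and eq: "\<And>w. w \<in> words m \<Longrightarrow> F (cylinder m w) = G (cylinder m w)"
  shows "F = G"
proof (rule PiE_ext)
  show "F \<in> sets (sequences m) \<rightarrow>\<^sub>E positive_ops" "G \<in> sets (sequences m) \<rightarrow>\<^sub>E positive_ops"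
    using F G by (auto simp: positive_op_measures_def)
  fix B assume B: "B \<in> sets (sequences m)"
  show "F B = G B"
  proof (rule blinfun_eq_inner)
    show "inner (F B h) k = inner (G B h) k" for h k
      by (rule sigma_additive_eqI[OF positive_op_measuresD(2)[OF F] positive_op_measuresD(2)[OF G] _ B])
         (simp add: eq)
  qed
qed

text \<open>
  The operator-valued form of \<open>sigma_additive_extension\<close>: an additive family of positive operators
  dominated by \<open>c E\<close> on cylinders comes from a measure dominated by \<open>c E\<close> on all Borel sets.
\<close>

lemma op_measure_extension:
  fixes E :: "'a::chilbert_space op_measure"
  assumes E: "E \<in> positive_op_measures m" and c: "c \<ge> 0"
    and G: "\<And>w. w \<in> words m \<Longrightarrow> G w \<in> positive_ops"
    and le: "\<And>w h. w \<in> words m \<Longrightarrow> inner (G w h) h \<le> c * inner (E (cylinder m w) h) h"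
    and add: "\<And>w. w \<in> words m \<Longrightarrow> G w = (\<Sum>j<m. G (w @ [j]))"
  obtains F where "F \<in> positive_op_measures m" "\<And>w. w \<in> words m \<Longrightarrow> F (cylinder m w) = G w"
    "\<And>B h. B \<in> sets (sequences m) \<Longrightarrow> inner (F B h) h \<le> c * inner (E B h) h"
proof -
  have "\<exists>N. sigma_additive m N \<and> (\<forall>B\<in>sets (sequences m). 0 \<le> N B \<and> N B \<le> c * inner (E B h) h) \<and>
      (\<forall>w\<in>words m. N (cylinder m w) = inner (G w h) h)" for h
  proof -
    have sum: "inner (G w h) h = (\<Sum>j<m. inner (G (w @ [j]) h) h)" if "w \<in> words m" for w
      by (subst add[OF that]) (simp add: blinfun.sum_left inner_sum_left)
    show ?thesis
    proof (rule sigma_additive_extension[OF positive_op_measuresD(2)[OF E, of h h],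
          where \<nu> = "\<lambda>w. inner (G w h) h" and c = c])
      show "0 \<le> inner (E B h) h" if "B \<in> sets (sequences m)" for B
        by (rule positive_opsD(3)[OF positive_op_measuresD(1)[OF E that]])
      show "0 \<le> inner (G w h) h" if "w \<in> words m" for w
        by (rule positive_opsD(3)[OF G[OF that]])
      show ?thesis if "sigma_additive m N" "\<And>B. B \<in> sets (sequences m) \<Longrightarrow> 0 \<le> N B"
        "\<And>B. B \<in> sets (sequences m) \<Longrightarrow> N B \<le> c * inner (E B h) h"
        "\<And>w. w \<in> words m \<Longrightarrow> N (cylinder m w) = inner (G w h) h" for N
        using that by blast
      show "inner (G w h) h \<le> c * inner (E (cylinder m w) h) h" if "w \<in> words m" for w
        by (rule le[OF that])
    qed (rule sum)
  qed
  then obtain L where L: "\<And>h. sigma_additive m (L h)"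
      "\<And>h B. B \<in> sets (sequences m) \<Longrightarrow> 0 \<le> L h B"
      "\<And>h B. B \<in> sets (sequences m) \<Longrightarrow> L h B \<le> c * inner (E B h) h"
      "\<And>h w. w \<in> words m \<Longrightarrow> L h (cylinder m w) = inner (G w h) h"
    by (metis (no_types, lifting))
  \<comment> \<open>Each identity for \<open>b\<close> below holds on cylinders and extends, both sides being countably additive in \<open>B\<close>.\<close>
  define b where "b B h k = 1/4 * (L (h + k) B - L (h - k) B)" for B h k
  have bad: "sigma_additive m (\<lambda>B. b B h k)" for h k
    unfolding b_def by (intro sigma_additive_mult sigma_additive_diff L)
  have bG: "b (cylinder m w) h k = inner (G w h) k" if "w \<in> words m" for w h k
  proof -
    have "inner (G w k) h = inner (G w h) k"
      using positive_opsD(2)[OF G[OF that], of k h] by (simp add: inner_commute)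
    then show ?thesis
      by (simp add: b_def L(4)[OF that] blinfun.add_right blinfun.diff_right inner_add inner_diff)
  qed
  have badd: "b B (h + h') k = b B h k + b B h' k" if "B \<in> sets (sequences m)" for B h h' k
    by (rule sigma_additive_eqI[OF bad sigma_additive_add[OF bad bad] _ that])
       (simp add: bG blinfun.add_right inner_add)
  have bscale: "b B (r *\<^sub>R h) k = r * b B h k" if "B \<in> sets (sequences m)" for B h k r
    by (rule sigma_additive_eqI[OF bad sigma_additive_mult[OF bad] _ that])
       (simp add: bG blinfun.scaleR_right)
  have bsym: "b B h k = b B k h" if "B \<in> sets (sequences m)" for B h k
  proof (rule sigma_additive_eqI[OF bad bad _ that])
    show "b (cylinder m w) h k = b (cylinder m w) k h" if "w \<in> words m" for w
      using positive_opsD(2)[OF G[OF that], of h k] by (simp add: bG[OF that] inner_commute)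
  qed
  have bdiag: "b B h h = L h B" if "B \<in> sets (sequences m)" for B h
    by (rule sigma_additive_eqI[OF bad L(1) _ that]) (simp add: bG L(4))
  have bi: "b B (\<i> *\<^sub>C h) k = -1 * b B h (\<i> *\<^sub>C k)" if "B \<in> sets (sequences m)" for B h k
  proof (rule sigma_additive_eqI[OF bad sigma_additive_mult[OF bad] _ that])
    show "b (cylinder m w) (\<i> *\<^sub>C h) k = -1 * b (cylinder m w) h (\<i> *\<^sub>C k)" if "w \<in> words m" for w
      using bounded_ops_commute_i[OF positive_opsD(1)[OF G[OF that]], of h]
        inner_scaleC_i[of "G w h" k] by (simp add: bG[OF that])
  qed
  have "\<exists>T :: 'a \<Rightarrow>\<^sub>L 'a. \<forall>h k. inner (T h) k = b B h k" if B: "B \<in> sets (sequences m)" for B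
  proof -
    define K where "K = c * norm (E B)"
    have K: "K \<ge> 0" using c by (simp add: K_def)
    have lin: "linear (\<lambda>h. b B h k)" for k
      by (intro linearI) (simp_all add: badd[OF B] bscale[OF B])
    then have lin2: "linear (b B h)" for h using bsym[OF B, of h] by presburger
    have diag: "0 \<le> b B h h" "b B h h \<le> K * (norm h)\<^sup>2" for h
    proof -
      show "0 \<le> b B h h" using L(2)[OF B] by (simp add: bdiag[OF B])
      have "inner (E B h) h \<le> norm (E B h) * norm h" by (rule norm_cauchy_schwarz)
      also have "\<dots> \<le> norm (E B) * (norm h)\<^sup>2"
        using mult_right_mono[OF norm_blinfun[of "E B" h], of "norm h"] by (simp add: power2_eq_square)
      finally have "c * inner (E B h) h \<le> K * (norm h)\<^sup>2"
        using c unfolding K_def by (simp add: mult.assoc mult_left_mono)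
      then show "b B h h \<le> K * (norm h)\<^sup>2" using L(3)[OF B, of h] by (simp add: bdiag[OF B])
    qed
    have bound: "\<bar>b B h k\<bar> \<le> K * norm h * norm k" for h k
    proof -
      have "(b B h k)\<^sup>2 \<le> b B h h * b B k k"
        by (rule psd_form_Cauchy_Schwarz) (use lin diag bsym[OF B] in auto)
      also have "\<dots> \<le> (K * (norm h)\<^sup>2) * (K * (norm k)\<^sup>2)"
        using diag K by (intro mult_mono) auto
      also have "\<dots> = (K * norm h * norm k)\<^sup>2" by (simp add: power2_eq_square)
      finally have "\<bar>b B h k\<bar> \<le> \<bar>K * norm h * norm k\<bar>" by (simp only: abs_le_square_iff)
      then show ?thesis using K by simp
    qed
    obtain T :: "'a \<Rightarrow>\<^sub>L 'a" where "\<And>h k. inner h (T k) = b B h k"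
      by (rule ex_form_representation[OF linear_ident lin lin2 bound K]) blast
    then have "\<forall>h k. inner (T h) k = b B h k" using bsym[OF B] by (metis inner_commute)
    then show ?thesis by blast
  qed
  then obtain T :: "(nat \<Rightarrow> nat) set \<Rightarrow> 'a \<Rightarrow>\<^sub>L 'a"
    where T: "\<And>B h k. B \<in> sets (sequences m) \<Longrightarrow> inner (T B h) k = b B h k" by metis
  define F where "F = restrict T (sets (sequences m))"
  have F: "inner (F B h) k = b B h k" if "B \<in> sets (sequences m)" for B h k
    using T[OF that] that by (simp add: F_def)
  have pos: "F B \<in> positive_ops" if B: "B \<in> sets (sequences m)" for B
  proof -
    have "F B (\<i> *\<^sub>C h) = \<i> *\<^sub>C F B h" for h
    proof (rule inner_cancel_right)
      fix k
      have "inner (F B (\<i> *\<^sub>C h)) k = inner (\<i> *\<^sub>C F B h) k"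
        by (simp add: inner_scaleC_i F[OF B] bi[OF B])
      then show "inner k (F B (\<i> *\<^sub>C h)) = inner k (\<i> *\<^sub>C F B h)" by (simp add: inner_commute)
    qed
    moreover have "inner (F B h) k = inner h (F B k)" for h k
      using F[OF B, of h k] F[OF B, of k h] bsym[OF B, of h k] by (simp add: inner_commute)
    moreover have "0 \<le> inner (F B h) h" for h
      using L(2)[OF B] by (simp add: F[OF B] bdiag[OF B])
    ultimately show ?thesis
      unfolding positive_ops_iff bounded_ops_iff psd_op_def symmetric_op_def by blast
  qed
  show ?thesis
  proof (rule that[of F])
    show "F \<in> positive_op_measures m"
    proof (rule positive_op_measuresI)
      show "F \<in> sets (sequences m) \<rightarrow>\<^sub>E positive_ops"
        using pos by (auto simp: F_def)
      show "sigma_additive m (\<lambda>B. inner (F B h) k)" for h k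
        unfolding sigma_additive_def
      proof (intro allI impI)
        fix A :: "nat \<Rightarrow> (nat \<Rightarrow> nat) set"
        assume A: "range A \<subseteq> sets (sequences m)" "disjoint_family A"
        then have "A n \<in> sets (sequences m)" "(\<Union>n. A n) \<in> sets (sequences m)" for n by auto
        then show "(\<lambda>n. inner (F (A n) h) k) sums inner (F (\<Union>n. A n) h) k"
          using sigma_additiveD[OF bad A, of h k] by (simp add: F)
      qed
    qed
    show "F (cylinder m w) = G w" if "w \<in> words m" for w
      by (rule blinfun_eq_inner) (simp add: F[OF cylinder_sets[OF that]] bG[OF that])
    show "inner (F B h) h \<le> c * inner (E B h) h" if "B \<in> sets (sequences m)" for B h
      using L(3)[OF that] by (simp add: F[OF that] bdiag[OF that])
  qed
qed


section \<open>The correspondence\<close>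

lemma sqrt_cyl_positive:
  assumes E: "E \<in> positive_op_measures m" and w: "w \<in> words m"
  shows "sqrt_cyl m E w \<in> positive_ops"
    and "(norm (sqrt_cyl m E w h))\<^sup>2 = inner (E (cylinder m w) h) h"
  using positive_op_measuresD(1)[OF E cylinder_sets[OF w]]
  by (simp_all add: sqrt_cyl_def op_sqrt_positive(1) norm_op_sqrt)

lemma op_measure_children:
  assumes F: "F \<in> positive_op_measures m" and w: "w \<in> words m"
  shows "F (cylinder m w) = (\<Sum>j<m. F (cylinder m (w @ [j])))"
proof (rule blinfun_eq_inner)
  fix h k
  show "inner (F (cylinder m w) h) k = inner ((\<Sum>j<m. F (cylinder m (w @ [j]))) h) k"
    using sigma_additive_cylinder[OF positive_op_measuresD(2)[OF F] w, of h k]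
    by (simp add: blinfun.sum_left inner_sum_left)
qed

lemma edge_contraction_props:
  assumes E: "E \<in> positive_op_measures m" and w: "w \<in> words m" and j: "j < m"
  shows "edge_contraction m E w j \<in> bounded_ops_between (range_space m E w) (range_space m E (w @ [j]))"
    and "edge_contraction m E w j (sqrt_cyl m E w h) = sqrt_cyl m E (w @ [j]) h"
proof -
  have wj: "w @ [j] \<in> words m" using w j by (simp add: in_words_snoc)
  have "norm (sqrt_cyl m E (w @ [j]) h) \<le> 1 * norm (sqrt_cyl m E w h)" for h
  proof -
    have "inner (E (cylinder m (w @ [j])) h) h \<le> (\<Sum>j<m. inner (E (cylinder m (w @ [j])) h) h)"
      using j w by (intro member_le_sum)
        (auto intro!: positive_opsD(3) positive_op_measuresD(1)[OF E] cylinder_sets simp: in_words_snoc)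
    also have "\<dots> = inner (E (cylinder m w) h) h"
      by (rule sigma_additive_cylinder[OF positive_op_measuresD(2)[OF E] w, symmetric])
    finally have "(norm (sqrt_cyl m E (w @ [j]) h))\<^sup>2 \<le> (norm (sqrt_cyl m E w h))\<^sup>2"
      by (simp add: sqrt_cyl_positive(2)[OF E] w wj)
    then show ?thesis by simp
  qed
  then have "\<exists>!C. C \<in> bounded_ops_between (range_space m E w) (range_space m E (w @ [j])) \<and>
      norm C \<le> 1 \<and> (\<forall>h. blinfun_apply C (sqrt_cyl m E w h) = sqrt_cyl m E (w @ [j]) h)"
    unfolding range_space_def
    by (intro ex1_range_contraction positive_opsD(1) sqrt_cyl_positive(1)[OF E] w wj) simp_all
  from theI'[OF this]
  show "edge_contraction m E w j \<in> bounded_ops_between (range_space m E w) (range_space m E (w @ [j]))"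
    and "edge_contraction m E w j (sqrt_cyl m E w h) = sqrt_cyl m E (w @ [j]) h"
    unfolding edge_contraction_def by blast+
qed

text \<open>
  Sandwiching the right-hand side of the martingale equation between \<open>sqrt_cyl m E w\<close> gives the sum of
  the sandwiched children, because each child square root is the edge contraction times the parent.
\<close>

lemma range_martingale_sum:
  assumes E: "E \<in> positive_op_measures m" and w: "w \<in> words m"
    and X: "\<And>j. j < m \<Longrightarrow>
      X j \<in> bounded_ops_between (range_space m E (w @ [j])) (range_space m E (w @ [j]))"
  defines "Y \<equiv> \<Sum>j<m. cadjoint (edge_contraction m E w j) o\<^sub>L X j o\<^sub>L edge_contraction m E w j"
  shows "Y \<in> bounded_ops_between (range_space m E w) (range_space m E w)"
    and "sqrt_cyl m E w o\<^sub>L Y o\<^sub>L sqrt_cyl m E w =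
      (\<Sum>j<m. sqrt_cyl m E (w @ [j]) o\<^sub>L X j o\<^sub>L sqrt_cyl m E (w @ [j]))"
proof -
  let ?C = "edge_contraction m E w" and ?R = "sqrt_cyl m E"
  have Rb: "?R w \<in> bounded_ops" by (rule positive_opsD(1)[OF sqrt_cyl_positive(1)[OF E w]])
  note between = bounded_ops_between_closure_range_iff[OF Rb, folded range_space_def]
  note C = edge_contraction_props[OF E w]
  have Cb: "?C j \<in> bounded_ops" if "j < m" for j using C(1)[OF that] by (simp add: between)
  have C0: "?C j x = 0" if "j < m" "\<forall>h. inner (?R w h) x = 0" for j x
    using C(1)[OF that(1)] that(2) by (simp add: between)
  have Xb: "X j \<in> bounded_ops" if "j < m" for j
    using X[OF that] by (simp add: bounded_ops_between_def)
  have Yapp: "Y x = (\<Sum>j<m. cadjoint (?C j) (X j (?C j x)))" for x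
    by (simp add: Y_def blinfun.sum_left)
  show "Y \<in> bounded_ops_between (range_space m E w) (range_space m E w)"
    unfolding between
  proof (intro conjI allI impI subsetI)
    show "Y \<in> bounded_ops"
      unfolding bounded_ops_iff Yapp
      using Cb Xb cadjoint_bounded_ops(1)[OF Cb]
      by (simp add: bounded_ops_commute_i
          linear_sum[OF bounded_linear.linear[OF bounded_linear_scaleC_i]])
    show "y \<in> range_space m E w" if "y \<in> range Y" for y
    proof -
      obtain x where x: "y = (\<Sum>j<m. cadjoint (?C j) (X j (?C j x)))" using \<open>y \<in> range Y\<close> Yapp by auto
      have "cadjoint (?C j) z \<in> range_space m E w" if "j < m" for j z
        using cadjoint_range_subset[OF Rb C(1)[OF that, unfolded range_space_def]]
        by (auto simp: range_space_def)
      then show ?thesis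
        unfolding x using subspace_closure_range[OF linear_blinfun_apply, of "?R w"]
        by (intro subspace_sum) (auto simp: range_space_def)
    qed
    show "Y x = 0" if "\<forall>h. inner (?R w h) x = 0" for x
      unfolding Yapp using C0[OF _ that] by (simp add: blinfun.zero_right)
  qed
  show "?R w o\<^sub>L Y o\<^sub>L ?R w = (\<Sum>j<m. ?R (w @ [j]) o\<^sub>L X j o\<^sub>L ?R (w @ [j]))"
  proof (rule blinfun_eq_inner)
    fix h k
    have "inner ((?R w o\<^sub>L Y o\<^sub>L ?R w) h) k = inner (Y (?R w h)) (?R w k)"
      by (simp add: positive_opsD(2)[OF sqrt_cyl_positive(1)[OF E w]])
    also have "\<dots> = (\<Sum>j<m. inner (cadjoint (?C j) (X j (?C j (?R w h)))) (?R w k))"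
      by (simp add: Yapp inner_sum_left)
    also have "\<dots> = (\<Sum>j<m. inner (?R (w @ [j]) (X j (?R (w @ [j]) h))) k)"
    proof (rule sum.cong)
      fix j assume "j \<in> {..<m}"
      then have j: "j < m" and wj: "w @ [j] \<in> words m" using w by (auto simp: in_words_snoc)
      have "inner (cadjoint (?C j) (X j (?C j (?R w h)))) (?R w k)
          = inner (?C j (?R w k)) (X j (?C j (?R w h)))"
        by (simp add: cadjoint_bounded_ops(2)[OF Cb[OF j]] inner_commute)
      then show "inner (cadjoint (?C j) (X j (?C j (?R w h)))) (?R w k)
          = inner (?R (w @ [j]) (X j (?R (w @ [j]) h))) k"
        by (simp add: C(2)[OF j] positive_opsD(2)[OF sqrt_cyl_positive(1)[OF E wj]] inner_commute)
    qed simp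
    finally show "inner ((?R w o\<^sub>L Y o\<^sub>L ?R w) h) k
        = inner ((\<Sum>j<m. ?R (w @ [j]) o\<^sub>L X j o\<^sub>L ?R (w @ [j])) h) k"
      by (simp add: blinfun.sum_left inner_sum_left)
  qed
qed

lemma zero_id_bounded_ops:
  "0 \<in> bounded_ops" "symmetric_op 0"
  "r *\<^sub>R id_blinfun \<in> bounded_ops" "symmetric_op (r *\<^sub>R id_blinfun)"
  by (simp_all add: bounded_ops_iff symmetric_op_def blinfun.scaleR_left
      scaleC_i_scaleR scaleC_i_zero)

lemma sqrt_cyl_compression_unique:
  assumes E: "E \<in> positive_op_measures m" and w: "w \<in> words m"
    and "X \<in> bounded_ops_between (range_space m E w) (range_space m E w)"
    and "Y \<in> bounded_ops_between (range_space m E w) (range_space m E w)"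
    and "sqrt_cyl m E w o\<^sub>L X o\<^sub>L sqrt_cyl m E w = sqrt_cyl m E w o\<^sub>L Y o\<^sub>L sqrt_cyl m E w"
  shows "X = Y"
  using compression_unique[OF sqrt_cyl_positive(1)[OF E w]] assms(3-) by (simp add: range_space_def)

lemma martingale_of_measure:
  assumes E: "E \<in> positive_op_measures m" and c: "c \<ge> 0"
    and F: "F \<in> positive_op_measures m" and dom: "dominated_by m F c E"
  obtains X where "positive_range_martingale m E X"
    "\<And>w. w \<in> words m \<Longrightarrow> op_le_on (range_space m E w) (X w) (c *\<^sub>R id_blinfun)"
    "\<And>w. w \<in> words m \<Longrightarrow> F (cylinder m w) = sqrt_cyl m E w o\<^sub>L X w o\<^sub>L sqrt_cyl m E w"
proof -
  let ?R = "sqrt_cyl m E"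
  have "\<exists>X. X \<in> bounded_ops_between (range_space m E w) (range_space m E w) \<and>
      ?R w o\<^sub>L X o\<^sub>L ?R w = F (cylinder m w) \<and> psd_op X \<and>
      (\<forall>x. inner (X x) x \<le> c * (norm x)\<^sup>2) \<and> norm X \<le> c" if w: "w \<in> words m" for w
  proof -
    have "inner (F (cylinder m w) h) h \<le> c * (norm (?R w h))\<^sup>2" for h
    proof -
      have "op_le_on UNIV (F (cylinder m w)) (c *\<^sub>R E (cylinder m w))"
        using dom cylinder_sets[OF w] by (simp add: dominated_by_def)
      then have "cinner ((c *\<^sub>R E (cylinder m w) - F (cylinder m w)) h) h \<in> \<real>\<^sub>\<ge>\<^sub>0"
        by (simp add: op_le_on_def)
      then have "0 \<le> inner ((c *\<^sub>R E (cylinder m w) - F (cylinder m w)) h) h"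
        by (simp add: complex_nonneg_Reals_iff Re_cinner)
      then show ?thesis
        by (simp add: sqrt_cyl_positive(2)[OF E w] blinfun.diff_left blinfun.scaleR_left inner_diff_left)
    qed
    then show ?thesis
      unfolding range_space_def
      by (rule ex_compression[OF sqrt_cyl_positive(1)[OF E w]
            positive_op_measuresD(1)[OF F cylinder_sets[OF w]] c]) blast
  qed
  then obtain X0 where X0: "\<And>w. w \<in> words m \<Longrightarrow>
      X0 w \<in> bounded_ops_between (range_space m E w) (range_space m E w) \<and>
      ?R w o\<^sub>L X0 w o\<^sub>L ?R w = F (cylinder m w) \<and> psd_op (X0 w) \<and>
      (\<forall>x. inner (X0 w x) x \<le> c * (norm x)\<^sup>2) \<and> norm (X0 w) \<le> c"
    by metis
  define X where "X = restrict X0 (words m)"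
  have X: "X w \<in> bounded_ops_between (range_space m E w) (range_space m E w)"
      "?R w o\<^sub>L X w o\<^sub>L ?R w = F (cylinder m w)" "psd_op (X w)"
      "inner (X w x) x \<le> c * (norm x)\<^sup>2" "norm (X w) \<le> c" if "w \<in> words m" for w x
    using X0[OF that] that by (simp_all add: X_def)
  have Xb: "X w \<in> bounded_ops" if "w \<in> words m" for w
    using X(1)[OF that] by (simp add: bounded_ops_between_def)
  have Xs: "symmetric_op (X w)" if "w \<in> words m" for w
    using X(3)[OF that] by (simp add: psd_op_def)
  have mart: "X w = (\<Sum>j<m. cadjoint (edge_contraction m E w j) o\<^sub>L X (w @ [j]) o\<^sub>L edge_contraction m E w j)"
    (is "_ = ?Y") if w: "w \<in> words m" for w
  proof (rule sqrt_cyl_compression_unique[OF E w X(1)[OF w]])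
    have wj: "w @ [j] \<in> words m" if "j < m" for j using w that by (simp add: in_words_snoc)
    show "?Y \<in> bounded_ops_between (range_space m E w) (range_space m E w)"
      by (rule range_martingale_sum(1)[OF E w]) (rule X(1)[OF wj])
    have "?R w o\<^sub>L ?Y o\<^sub>L ?R w = (\<Sum>j<m. ?R (w @ [j]) o\<^sub>L X (w @ [j]) o\<^sub>L ?R (w @ [j]))"
      by (rule range_martingale_sum(2)[OF E w]) (rule X(1)[OF wj])
    also have "\<dots> = (\<Sum>j<m. F (cylinder m (w @ [j])))"
      using X(2)[OF wj] by (intro sum.cong) auto
    also have "\<dots> = ?R w o\<^sub>L X w o\<^sub>L ?R w"
      unfolding X(2)[OF w] by (rule op_measure_children[OF F w, symmetric])
    finally show "?R w o\<^sub>L X w o\<^sub>L ?R w = ?R w o\<^sub>L ?Y o\<^sub>L ?R w" by (rule sym)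
  qed
  show ?thesis
  proof (rule that[of X])
    show "positive_range_martingale m E X"
      unfolding positive_range_martingale_def bounded_range_martingale_def
    proof (intro conjI ballI)
      show "X \<in> (\<Pi>\<^sub>E w\<in>words m. bounded_ops_between (range_space m E w) (range_space m E w))"
        using X(1) by (auto simp: X_def)
      show "bdd_above ((\<lambda>w. norm (X w)) ` words m)"
        using X(5) by (intro bdd_aboveI[of _ c]) auto
      show "cadjoint (X w) = X w" if "w \<in> words m" for w
        using cadjoint_eq_self_iff[OF Xb[OF that]] Xs[OF that] by simp
      show "op_le_on (range_space m E w) 0 (X w)" if "w \<in> words m" for w
        using X(3)[OF that] unfolding op_le_on_iff[OF zero_id_bounded_ops(1,2) Xb[OF that] Xs[OF that]]
        by (simp add: psd_op_def)
    qed (rule mart)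
    show "op_le_on (range_space m E w) (X w) (c *\<^sub>R id_blinfun)" if "w \<in> words m" for w
      using X(4)[OF that] unfolding op_le_on_iff[OF Xb[OF that] Xs[OF that] zero_id_bounded_ops(3,4)]
      by (simp add: blinfun.scaleR_left power2_norm_eq_inner)
    show "F (cylinder m w) = ?R w o\<^sub>L X w o\<^sub>L ?R w" if "w \<in> words m" for w
      using X(2)[OF that] by simp
  qed
qed

lemma measure_of_martingale:
  assumes E: "E \<in> positive_op_measures m" and c: "c \<ge> 0"
    and mart: "positive_range_martingale m E X"
    and le: "\<And>w. w \<in> words m \<Longrightarrow> op_le_on (range_space m E w) (X w) (c *\<^sub>R id_blinfun)"
  obtains F where "F \<in> positive_op_measures m" "dominated_by m F c E"
    "\<And>w. w \<in> words m \<Longrightarrow> F (cylinder m w) = sqrt_cyl m E w o\<^sub>L X w o\<^sub>L sqrt_cyl m E w"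
proof -
  let ?R = "sqrt_cyl m E"
  have X: "X w \<in> bounded_ops_between (range_space m E w) (range_space m E w)"
      "cadjoint (X w) = X w" "op_le_on (range_space m E w) 0 (X w)"
      "X w = (\<Sum>j<m. cadjoint (edge_contraction m E w j) o\<^sub>L X (w @ [j]) o\<^sub>L edge_contraction m E w j)"
    if "w \<in> words m" for w
    using mart that unfolding positive_range_martingale_def bounded_range_martingale_def by blast+
  have Xb: "X w \<in> bounded_ops" if "w \<in> words m" for w
    using X(1)[OF that] by (simp add: bounded_ops_between_def)
  have Xs: "symmetric_op (X w)" if "w \<in> words m" for w
    using cadjoint_eq_self_iff[OF Xb[OF that]] X(2)[OF that] by simp
  have Rin: "?R w h \<in> range_space m E w" for w h
    unfolding range_space_def by (meson closure_subset rangeI subsetD)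
  define G where "G w = ?R w o\<^sub>L X w o\<^sub>L ?R w" for w
  have Gin: "inner (G w h) k = inner (X w (?R w h)) (?R w k)" if "w \<in> words m" for w h k
    by (simp add: G_def positive_opsD(2)[OF sqrt_cyl_positive(1)[OF E that]])
  have X0: "0 \<le> inner (X w (?R w h)) (?R w h)" if "w \<in> words m" for w h
    using X(3)[OF that] Rin[of w h]
    unfolding op_le_on_iff[OF zero_id_bounded_ops(1,2) Xb[OF that] Xs[OF that]] by fastforce
  have Xc: "inner (X w (?R w h)) (?R w h) \<le> c * (norm (?R w h))\<^sup>2" if "w \<in> words m" for w h
    using le[OF that] Rin[of w h]
    unfolding op_le_on_iff[OF Xb[OF that] Xs[OF that] zero_id_bounded_ops(3,4)]
    by (simp add: blinfun.scaleR_left power2_norm_eq_inner)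
  have Gpos: "G w \<in> positive_ops" if w: "w \<in> words m" for w
    unfolding positive_ops_iff psd_op_def symmetric_op_def
  proof (intro conjI allI)
    show "G w \<in> bounded_ops"
      unfolding G_def
      by (intro bounded_ops_compose Xb w positive_opsD(1)[OF sqrt_cyl_positive(1)[OF E w]])
    fix h k
    have "inner (X w (?R w h)) (?R w k) = inner (?R w h) (X w (?R w k))"
      using Xs[OF w] by (simp add: symmetric_op_def)
    then show "inner (G w h) k = inner h (G w k)"
      using Gin[OF w, of h k] Gin[OF w, of k h] by (simp add: inner_commute)
    show "0 \<le> inner (G w h) h" using X0[OF w] by (simp add: Gin[OF w])
  qed
  have Gle: "inner (G w h) h \<le> c * inner (E (cylinder m w) h) h" if "w \<in> words m" for w h
    using Xc[OF that, of h] by (simp add: Gin[OF that] sqrt_cyl_positive(2)[OF E that])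
  have Gadd: "G w = (\<Sum>j<m. G (w @ [j]))" if w: "w \<in> words m" for w
  proof -
    have wj: "w @ [j] \<in> words m" if "j < m" for j using w that by (simp add: in_words_snoc)
    have "G w = ?R w o\<^sub>L (\<Sum>j<m. cadjoint (edge_contraction m E w j) o\<^sub>L X (w @ [j])
        o\<^sub>L edge_contraction m E w j) o\<^sub>L ?R w"
      unfolding G_def by (subst X(4)[OF w]) (rule refl)
    also have "\<dots> = (\<Sum>j<m. G (w @ [j]))"
      unfolding G_def by (rule range_martingale_sum(2)[OF E w]) (rule X(1)[OF wj])
    finally show ?thesis .
  qed
  show ?thesis
  proof (rule op_measure_extension[OF E c Gpos Gle Gadd])
    fix F
    assume F: "F \<in> positive_op_measures m" "\<And>w. w \<in> words m \<Longrightarrow> F (cylinder m w) = G w"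
      "\<And>B h. B \<in> sets (sequences m) \<Longrightarrow> inner (F B h) h \<le> c * inner (E B h) h"
    have "dominated_by m F c E"
      unfolding dominated_by_def
    proof (intro ballI conjI)
      fix B assume B: "B \<in> sets (sequences m)"
      note FB = positive_op_measuresD(1)[OF F(1) B] and EB = positive_op_measuresD(1)[OF E B]
      show "op_le_on UNIV 0 (F B)" using FB by (simp add: positive_ops_def)
      have cE: "c *\<^sub>R E B \<in> positive_ops"
        using EB c
        by (simp add: psd_op_scaleR positive_ops_iff bounded_ops_iff blinfun.scaleR_left scaleC_i_scaleR)
      show "op_le_on UNIV (F B) (c *\<^sub>R E B)"
        using FB cE F(3)[OF B]
        by (subst op_le_on_iff) (auto simp: positive_ops_iff psd_op_def blinfun.scaleR_left)
    qed
    then show ?thesis by (rule that[OF F(1)]) (use F(2) in \<open>simp add: G_def\<close>)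
  qed
qed

theorem theorem5p2:
  fixes m :: nat
    and E :: "'a::chilbert_space op_measure"
    and c :: real
  assumes "m \<ge> 2"
    and "povm m E"
    and "c > 0"
  defines "Dom \<equiv> {F \<in> positive_op_measures m. dominated_by m F c E}"
    and "Mart \<equiv> {X. positive_range_martingale m E X \<and>
           (\<forall>w\<in>words m. op_le_on (range_space m E w) 0 (X w) \<and>
                         op_le_on (range_space m E w) (X w) (c *\<^sub>R id_blinfun))}"
  shows "\<exists>\<Phi>. bij_betw \<Phi> Dom Mart \<and>
           (\<forall>F\<in>Dom. \<forall>X\<in>Mart. \<Phi> F = X \<longleftrightarrow>
              (\<forall>w\<in>words m. F (cylinder m w) = sqrt_cyl m E w o\<^sub>L X w o\<^sub>L sqrt_cyl m E w))"
proof -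
  define rel where "rel F X \<longleftrightarrow>
    (\<forall>w\<in>words m. F (cylinder m w) = sqrt_cyl m E w o\<^sub>L X w o\<^sub>L sqrt_cyl m E w)" for F X
  have E: "E \<in> positive_op_measures m" using assms(2) by (simp add: povm_def)
  have c: "c \<ge> 0" using assms(3) by simp
  have ex_X: "\<exists>X\<in>Mart. rel F X" if F: "F \<in> Dom" for F
  proof -
    have F': "F \<in> positive_op_measures m" "dominated_by m F c E" using F by (auto simp: Dom_def)
    show ?thesis
    proof (rule martingale_of_measure[OF E c F'])
      fix X
      assume X: "positive_range_martingale m E X"
        "\<And>w. w \<in> words m \<Longrightarrow> op_le_on (range_space m E w) (X w) (c *\<^sub>R id_blinfun)"
        "\<And>w. w \<in> words m \<Longrightarrow> F (cylinder m w) = sqrt_cyl m E w o\<^sub>L X w o\<^sub>L sqrt_cyl m E w"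
      then have "X \<in> Mart" by (simp add: Mart_def positive_range_martingale_def)
      moreover have "rel F X" using X(3) by (simp add: rel_def)
      ultimately show ?thesis by blast
    qed
  qed
  have ex_F: "\<exists>F\<in>Dom. rel F X" if X: "X \<in> Mart" for X
  proof -
    have X': "positive_range_martingale m E X"
      "\<And>w. w \<in> words m \<Longrightarrow> op_le_on (range_space m E w) (X w) (c *\<^sub>R id_blinfun)"
      using X by (auto simp: Mart_def)
    show ?thesis
    proof (rule measure_of_martingale[OF E c X'])
      fix F
      assume F: "F \<in> positive_op_measures m" "dominated_by m F c E"
        "\<And>w. w \<in> words m \<Longrightarrow> F (cylinder m w) = sqrt_cyl m E w o\<^sub>L X w o\<^sub>L sqrt_cyl m E w"
      then have "F \<in> Dom" by (simp add: Dom_def)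
      moreover have "rel F X" using F(3) by (simp add: rel_def)
      ultimately show ?thesis by blast
    qed
  qed
  have unique_X: "X = Y" if X: "X \<in> Mart" and Y: "Y \<in> Mart" and rel: "rel F X" "rel F Y" for F X Y
  proof (rule PiE_ext)
    show PiE: "X \<in> (\<Pi>\<^sub>E w\<in>words m. bounded_ops_between (range_space m E w) (range_space m E w))"
      "Y \<in> (\<Pi>\<^sub>E w\<in>words m. bounded_ops_between (range_space m E w) (range_space m E w))"
      using X Y
      by (simp_all add: Mart_def positive_range_martingale_def bounded_range_martingale_def)
    fix w assume w: "w \<in> words m"
    have "sqrt_cyl m E w o\<^sub>L X w o\<^sub>L sqrt_cyl m E w = F (cylinder m w)"
      "F (cylinder m w) = sqrt_cyl m E w o\<^sub>L Y w o\<^sub>L sqrt_cyl m E w"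
      using rel w unfolding rel_def by simp_all
    then show "X w = Y w"
      by (intro sqrt_cyl_compression_unique[OF E w PiE_mem[OF PiE(1) w] PiE_mem[OF PiE(2) w]])
         (rule trans)
  qed
  have unique_F: "F = G" if "F \<in> Dom" "G \<in> Dom" "rel F X" "rel G X" for F G X
  proof (rule positive_op_measures_eqI)
    show "F \<in> positive_op_measures m" "G \<in> positive_op_measures m"
      using that by (simp_all add: Dom_def)
    show "F (cylinder m w) = G (cylinder m w)" if "w \<in> words m" for w
      using \<open>rel F X\<close> \<open>rel G X\<close> that unfolding rel_def by simp
  qed
  \<comment> \<open>By \<open>ex_X\<close> and \<open>unique_X\<close> the choice is forced on \<open>Dom\<close>.\<close>
  define \<Phi> where "\<Phi> F = (SOME X. X \<in> Mart \<and> rel F X)" for F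
  have \<Phi>: "\<Phi> F \<in> Mart" "rel F (\<Phi> F)" if "F \<in> Dom" for F
    using someI_ex[of "\<lambda>X. X \<in> Mart \<and> rel F X"] ex_X[OF that] by (auto simp: \<Phi>_def)
  have iff: "\<Phi> F = X \<longleftrightarrow> rel F X" if "F \<in> Dom" "X \<in> Mart" for F X
    using \<Phi>[OF that(1)] unique_X that(2) by blast
  have "bij_betw \<Phi> Dom Mart"
  proof (rule bij_betw_imageI)
    show "inj_on \<Phi> Dom"
      using unique_F \<Phi>(2) by (intro inj_onI) metis
    show "\<Phi> ` Dom = Mart"
      using \<Phi>(1) ex_F iff by blast
  qed
  then show ?thesis using iff unfolding rel_def by blast
qed

end
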